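(* Consider the linear system with three input delays $$\dot x(t)=Ax(t)+B_1u(t-\tau_1)+B_2u(t-\tau_2)+B_3u(t-\tau_3),$$ where $A\in\mathbf{R}^{n\times n}$, $B_i\in\mathbf{R}^{n\times m}$ ($i=1,2,3$) are constant matrices and $0\le\tau_1\le\tau_2\le\tau_3<\infty$ are constants. Let $\tau=\tau_1+\tau_2+\tau_3$ and $B=\mathrm{e}^{-A\tau_1}B_1+\mathrm{e}^{-A\tau_2}B_2+\mathrm{e}^{-A\tau_3}B_3$. Assume that $(A,B)$ is controllable and that all the eigenvalues of $A$ are on the imaginary axis. For $\gamma>0$ let $F=F(\gamma)=-B^{\mathrm{T}}P$, where $P=P(\gamma)$ is the unique positive definite solution to the parametric algebraic Riccati equation $$A^{\mathrm{T}}P+PA-PBB^{\mathrm{T}}P=-\gamma P.$$ Then there exists a scalar $\gamma^{\ast}>0$ such that the closed-loop system consisting of the linear system $\dot x(t)=Ax(t)+B_1u(t-\tau_1)+B_2u(t-\tau_2)+B_3u(t-\tau_3)$ and the truncated pseudo-predictor feedback $$u(t)=F\mathrm{e}^{(A+BF)\tau}\mathrm{e}^{-A\tau}x(t)$$ is asymptotically stable for all $\gamma\in(0,\gamma^{\ast})$.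
   Context: Under the assumption that $(A,B)$ is controllable with all eigenvalues of $A$ on the imaginary axis, it is known that for every $\gamma>0$ the parametric Riccati equation $A^{\mathrm{T}}P+PA-PBB^{\mathrm{T}}P=-\gamma P$ has a unique positive definite solution $P(\gamma)$, namely $P(\gamma)=W(\gamma)^{-1}$ where $W(\gamma)$ is the unique positive definite solution of $W(A+\frac{\gamma}{2}I_n)^{\mathrm{T}}+(A+\frac{\gamma}{2}I_n)W=BB^{\mathrm{T}}$. Asymptotic stability is meant in the usual sense for linear time-delay systems. *)

theory Defs
  imports "HOL-Analysis.Analysis"
begin

(* The type real^'n^'n is not an instance of real_normed_algebra_1 (its multiplication is
   componentwise), so the library constant exp does not apply to it. *)
definition matrix_exp :: "real^'n^'n \<Rightarrow> real^'n^'n" where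
  "matrix_exp A = (\<Sum>k. (1 / fact k) *\<^sub>R (((**) A ^^ k) (mat 1)))"

definition complex_eigenvalue :: "real^'n^'n \<Rightarrow> complex \<Rightarrow> bool" where
  "complex_eigenvalue A \<mu> \<longleftrightarrow>
     (\<exists>v :: complex^'n. v \<noteq> 0 \<and> map_matrix complex_of_real A *v v = \<mu> *s v)"

definition positive_definite :: "real^'n^'n \<Rightarrow> bool" where
  "positive_definite P \<longleftrightarrow> transpose P = P \<and> (\<forall>x. x \<noteq> 0 \<longrightarrow> x \<bullet> (P *v x) > 0)"

(* Point-to-point controllability; for linear time-invariant systems, restricting to continuous
   inputs and fixing or not fixing the transfer time makes no difference. *)
definition controllable :: "real^'n^'n \<Rightarrow> real^'m^'n \<Rightarrow> bool" where
  "controllable A B \<longleftrightarrow>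
     (\<forall>x0 x1. \<exists>T>0. \<exists>(u :: real \<Rightarrow> real^'m) (x :: real \<Rightarrow> real^'n).
        continuous_on {0..T} u \<and> x 0 = x0 \<and> x T = x1 \<and>
        (\<forall>t\<in>{0..T}. (x has_vector_derivative (A *v x t + B *v u t)) (at t within {0..T})))"

definition riccati :: "real^'n^'n \<Rightarrow> real^'m^'n \<Rightarrow> real \<Rightarrow> real^'n^'n \<Rightarrow> bool" where
  "riccati A B \<gamma> P \<longleftrightarrow>
     transpose A ** P + P ** A - P ** B ** transpose B ** P = - (\<gamma> *\<^sub>R P)"

(* Solutions on [-\<tau>3, \<infinity>) of the delay system under the static feedback u(t) = K x(t); the
   restriction of x to [-\<tau>3, 0] is an arbitrary continuous initial function, and the
   derivative at 0 is one-sided. *)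
definition closed_loop_solutions ::
  "real^'n^'n \<Rightarrow> real^'m^'n \<Rightarrow> real^'m^'n \<Rightarrow> real^'m^'n \<Rightarrow> real \<Rightarrow> real \<Rightarrow> real \<Rightarrow> real^'n^'m
    \<Rightarrow> (real \<Rightarrow> real^'n) set" where
  "closed_loop_solutions A B1 B2 B3 \<tau>1 \<tau>2 \<tau>3 K =
     {x. continuous_on {-\<tau>3..} x \<and>
         (\<exists>u. (\<forall>t\<ge>-\<tau>3. u t = K *v x t) \<and>
              (\<forall>t\<ge>0. (x has_vector_derivative
                   (A *v x t + B1 *v u (t - \<tau>1) + B2 *v u (t - \<tau>2) + B3 *v u (t - \<tau>3)))
                 (at t within {0..})))}"

(* Asymptotic stability of the zero solution of a linear time-delay system with maximal delay r
   and solution set S: Lyapunov stability together with attractivity.  By linearity, local and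
   global attractivity coincide. *)
definition asymptotically_stable :: "real \<Rightarrow> (real \<Rightarrow> 'a::real_normed_vector) set \<Rightarrow> bool" where
  "asymptotically_stable r S \<longleftrightarrow>
     (\<forall>\<epsilon>>0. \<exists>\<delta>>0. \<forall>x\<in>S. (\<forall>s\<in>{-r..0}. norm (x s) < \<delta>) \<longrightarrow> (\<forall>t\<ge>0. norm (x t) < \<epsilon>)) \<and>
     (\<forall>x\<in>S. (x \<longlongrightarrow> 0) at_top)"

end

(* Artstein's transformation z(t) = x(t) + (integrals of past inputs, one for each delay) turns the
   closed loop into z' = A z + B u.  Let V be the quadratic form of P.  Along z' = A z + B u the
   Riccati equation gives V(z)' <= - gamma V(z) + |u - F z|^2, so everything rests on the smallness
   of u - F z.  Since all eigenvalues of A are imaginary, trace A = 0, hence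
   trace (B^T P B) = n gamma and |F v|^2 <= n gamma V(v); the controllability Gramian bounds P
   uniformly for gamma <= 1.  With M = exp((A + B F) tau) exp(- A tau) one has
   u - F z = F (M x - x) + F (x - z); both arguments of F have squares of order gamma, and F
   contributes another factor gamma, so |u - F z|^2 <= c gamma^2 (V(x(t)) + J(t)) with J(t) the
   integral of V(x) over [t - tau3, t].
   This is quadratic in gamma while the decay rate is linear, so a Lyapunov-Krasovskii functional
   decays exponentially once gamma is small. *)

theory Submission
  imports Defs "HOL-Computational_Algebra.Fundamental_Theorem_Algebra"
begin

section \<open>The matrix exponential\<close>

text \<open>As \<gamma> tends to 0, so does \<open>P\<close>; hence no lower bound on
  \<open>P\<close> is uniform in \<gamma>, yet the threshold for \<gamma> has to be fixed before
  \<open>P\<close> is given. The estimates are therefore arranged to need only an upper bound on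
  \<open>P\<close>: a form V(y) is replaced by p |y|^2, and the way back from norms to V always
  leads through \<open>F\<close>, where |F y|^2 is at most n \<gamma> V(y), which even gains a
  factor \<gamma>. A lower bound on \<open>P\<close> enters once, at the very end, when \<gamma> is
  already fixed and the constant may depend on it. The history integral J is forced by the
  transformation: x - z depends on the inputs over a whole delay window, so V(x(t)) cannot be
  controlled by V(z(t)) alone. The functional thus needs a term whose derivative contains -J. Its
  weight is a multiple of \<gamma>^2, large enough to pay for the error terms and small enough, for
  small \<gamma>, not to spoil the decay - \<gamma> V(z).\<close>

lemma bounded_bilinear_matrix_vector_mult:
  "bounded_bilinear ((*v) :: real^'n^'m \<Rightarrow> real^'n \<Rightarrow> real^'m)"
proof -
  have "bilinear ((*v) :: real^'n^'m \<Rightarrow> real^'n \<Rightarrow> real^'m)"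
    unfolding bilinear_def
    by (auto intro!: linearI simp: matrix_vector_right_distrib matrix_vector_mult_add_rdistrib
        scaleR_matrix_vector_assoc [symmetric] matrix_vector_mult_scaleR)
  then show ?thesis
    by (simp add: bilinear_conv_bounded_bilinear)
qed

lemmas has_vector_derivative_matrix_vector_mult =
  bounded_bilinear.has_vector_derivative [OF bounded_bilinear_matrix_vector_mult]

abbreviation matrix_power :: "real^'n^'n \<Rightarrow> nat \<Rightarrow> real^'n^'n" where
  "matrix_power A k \<equiv> ((**) A ^^ k) (mat 1)"

text \<open>The sum of the absolute values of all entries dominates every absolute row sum, which is
  all that the induction needs. The bound supplies a scalar exponential series as majorant.\<close>

lemma matrix_power_entry_bound:
  fixes A :: "real^'n^'n"
  shows "\<bar>matrix_power A k $ i $ j\<bar> \<le> (\<Sum>i\<in>UNIV. \<Sum>l\<in>UNIV. \<bar>A $ i $ l\<bar>) ^ k"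
proof (induction k arbitrary: i j)
  case 0
  then show ?case by (simp add: mat_def)
next
  case (Suc k)
  let ?C = "\<Sum>i\<in>UNIV. \<Sum>l\<in>UNIV. \<bar>A $ i $ l\<bar>"
  have "\<bar>matrix_power A (Suc k) $ i $ j\<bar> = \<bar>\<Sum>l\<in>UNIV. A $ i $ l * matrix_power A k $ l $ j\<bar>"
    by (simp add: matrix_matrix_mult_def)
  also have "\<dots> \<le> (\<Sum>l\<in>UNIV. \<bar>A $ i $ l\<bar> * ?C ^ k)"
    by (intro order_trans [OF sum_abs] sum_mono) (auto simp: abs_mult intro!: mult_left_mono Suc)
  also have "\<dots> = (\<Sum>l\<in>UNIV. \<bar>A $ i $ l\<bar>) * ?C ^ k"
    by (simp add: sum_distrib_right)
  also have "\<dots> \<le> ?C * ?C ^ k"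
    by (intro mult_right_mono member_le_sum [where f = "\<lambda>i. \<Sum>l\<in>UNIV. \<bar>A $ i $ l\<bar>"])
      (auto intro!: sum_nonneg zero_le_power)
  finally show ?case by simp
qed

lemma matrix_power_scaleR:
  fixes A :: "real^'n^'n"
  shows "matrix_power (t *\<^sub>R A) k = t ^ k *\<^sub>R matrix_power A k"
  by (induction k) (simp_all add: scalar_matrix_assoc matrix_scalar_ac mult_ac)

lemma matrix_power_commute:
  fixes A :: "real^'n^'n"
  shows "A ** matrix_power A k = matrix_power A k ** A"
proof (induction k)
  case (Suc k)
  then show ?case by (simp only: funpow.simps o_def matrix_mul_assoc)
qed simp

lemma summable_matrix_exp_entry:
  fixes A :: "real^'n^'n"
  shows "summable (\<lambda>k. matrix_power A k $ i $ j / fact k * t ^ k)"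
proof (rule summable_comparison_test')
  let ?C = "\<Sum>i\<in>UNIV. \<Sum>l\<in>UNIV. \<bar>A $ i $ l\<bar>"
  show "summable (\<lambda>k. inverse (fact k) * (?C * \<bar>t\<bar>) ^ k)"
    by (rule summable_exp)
  show "norm (matrix_power A k $ i $ j / fact k * t ^ k) \<le> inverse (fact k) * (?C * \<bar>t\<bar>) ^ k" for k
    using mult_right_mono [OF matrix_power_entry_bound [where A = A and k = k and i = i and j = j], of "\<bar>t\<bar> ^ k"]
    by (simp add: abs_mult power_abs field_simps power_mult_distrib)
qed

text \<open>Reduces the matrix series to one scalar power series in \<open>t\<close> per entry, so
  that termwise differentiation of power series applies.\<close>

lemma matrix_exp_entry:
  fixes A :: "real^'n^'n"
  shows "matrix_exp (t *\<^sub>R A) $ i $ j = (\<Sum>k. matrix_power A k $ i $ j / fact k * t ^ k)"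
proof -
  have "(\<lambda>k. (1 / fact k) *\<^sub>R matrix_power (t *\<^sub>R A) k) sums
      (\<chi> i j. \<Sum>k. matrix_power A k $ i $ j / fact k * t ^ k)"
    unfolding sums_def
  proof (intro vec_tendstoI)
    fix i j
    show "(\<lambda>n. (\<Sum>k<n. (1 / fact k) *\<^sub>R matrix_power (t *\<^sub>R A) k) $ i $ j) \<longlonglongrightarrow>
      (\<chi> i j. \<Sum>k. matrix_power A k $ i $ j / fact k * t ^ k) $ i $ j"
      using summable_LIMSEQ [OF summable_matrix_exp_entry [of A i j t]]
      by (simp add: matrix_power_scaleR mult.commute)
  qed
  then show ?thesis
    by (simp add: matrix_exp_def sums_iff)
qed

lemma matrix_exp_zero [simp]: "matrix_exp (0 :: real^'n^'n) = mat 1"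
proof -
  have "matrix_exp (0 *\<^sub>R mat 1 :: real^'n^'n) $ i $ j = mat 1 $ i $ j" for i j :: 'n
    unfolding matrix_exp_entry by (subst powser_zero) simp
  then show ?thesis by (simp add: vec_eq_iff)
qed

lemma matrix_exp_commute:
  fixes A :: "real^'n^'n"
  shows "A ** matrix_exp (t *\<^sub>R A) = matrix_exp (t *\<^sub>R A) ** A"
proof -
  note s = summable_matrix_exp_entry
  have "(A ** matrix_exp (t *\<^sub>R A)) $ i $ j = (matrix_exp (t *\<^sub>R A) ** A) $ i $ j" for i j
  proof -
    have "(A ** matrix_exp (t *\<^sub>R A)) $ i $ j
        = (\<Sum>l\<in>UNIV. \<Sum>k. A $ i $ l * (matrix_power A k $ l $ j / fact k * t ^ k))"
      by (simp add: matrix_matrix_mult_def matrix_exp_entry suminf_mult [OF s] del: times_divide_eq_left times_divide_eq_right)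
    also have "\<dots> = (\<Sum>k. \<Sum>l\<in>UNIV. A $ i $ l * (matrix_power A k $ l $ j / fact k * t ^ k))"
      by (rule suminf_sum [symmetric]) (intro summable_mult s)
    also have "\<dots> = (\<Sum>k. (A ** matrix_power A k) $ i $ j / fact k * t ^ k)"
      by (simp add: matrix_matrix_mult_def sum_divide_distrib sum_distrib_right mult.assoc)
    also have "\<dots> = (\<Sum>k. (matrix_power A k ** A) $ i $ j / fact k * t ^ k)"
      by (simp only: matrix_power_commute)
    also have "\<dots> = (\<Sum>k. \<Sum>l\<in>UNIV. matrix_power A k $ i $ l / fact k * t ^ k * A $ l $ j)"
      by (simp add: matrix_matrix_mult_def sum_divide_distrib sum_distrib_left sum_distrib_right mult_ac)
    also have "\<dots> = (\<Sum>l\<in>UNIV. \<Sum>k. matrix_power A k $ i $ l / fact k * t ^ k * A $ l $ j)"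
      by (rule suminf_sum) (intro summable_mult2 s)
    also have "\<dots> = (matrix_exp (t *\<^sub>R A) ** A) $ i $ j"
      by (simp add: matrix_matrix_mult_def matrix_exp_entry suminf_mult2 [OF s] del: times_divide_eq_left times_divide_eq_right)
    finally show ?thesis .
  qed
  then show ?thesis by (simp add: vec_eq_iff)
qed

lemma matrix_exp_has_vector_derivative:
  fixes A :: "real^'n^'n"
  shows "((\<lambda>t. matrix_exp (t *\<^sub>R A)) has_vector_derivative A ** matrix_exp (t *\<^sub>R A)) (at t within S)"
proof -
  note s = summable_matrix_exp_entry
  have "((\<lambda>t. matrix_exp (t *\<^sub>R A) $ i $ j) has_real_derivative (A ** matrix_exp (t *\<^sub>R A)) $ i $ j)
      (at t within S)" for i j
  proof -
    let ?c = "\<lambda>k. matrix_power A k $ i $ j / fact k"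
    have "DERIV (\<lambda>t. \<Sum>k. ?c k * t ^ k) t :> (\<Sum>k. diffs ?c k * t ^ k)"
      by (rule termdiffs_strong_converges_everywhere) (rule s)
    moreover have "(\<Sum>k. diffs ?c k * t ^ k) = (A ** matrix_exp (t *\<^sub>R A)) $ i $ j"
    proof -
      have "diffs ?c k = (\<Sum>l\<in>UNIV. A $ i $ l * (matrix_power A k $ l $ j / fact k))" for k
        by (simp add: diffs_def matrix_matrix_mult_def sum_distrib_left field_simps
            del: of_nat_Suc)
      then have "(\<Sum>k. diffs ?c k * t ^ k)
          = (\<Sum>k. \<Sum>l\<in>UNIV. A $ i $ l * (matrix_power A k $ l $ j / fact k * t ^ k))"
        by (simp add: sum_distrib_right mult.assoc)
      also have "\<dots> = (\<Sum>l\<in>UNIV. \<Sum>k. A $ i $ l * (matrix_power A k $ l $ j / fact k * t ^ k))"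
        by (rule suminf_sum) (intro summable_mult s)
      finally show ?thesis
        by (simp add: matrix_matrix_mult_def matrix_exp_entry suminf_mult [OF s]
            del: times_divide_eq_left times_divide_eq_right)
    qed
    ultimately show ?thesis
      by (simp add: matrix_exp_entry has_field_derivative_at_within)
  qed
  then show ?thesis
    unfolding has_vector_derivative_def
    by (subst has_derivative_componentwise_within)
      (auto simp: Basis_vec_def inner_axis has_field_derivative_def mult_commute_abs)
qed

lemma matrix_exp_comp_has_vector_derivative:
  assumes "(f has_real_derivative f') (at t within S)"
  shows "((\<lambda>t. matrix_exp (f t *\<^sub>R A)) has_vector_derivative f' *\<^sub>R (A ** matrix_exp (f t *\<^sub>R A)))
    (at t within S)"
  using vector_diff_chain_within [OF assms [unfolded has_real_derivative_iff_has_vector_derivative]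
    matrix_exp_has_vector_derivative]
  by (simp add: o_def)

lemma matrix_exp_comp_vector:
  assumes "(f has_real_derivative f') (at t within S)"
  shows "((\<lambda>t. matrix_exp (f t *\<^sub>R A) *v y) has_vector_derivative
    (f' *\<^sub>R (A ** matrix_exp (f t *\<^sub>R A))) *v y) (at t within S)"
  using has_vector_derivative_matrix_vector_mult
    [OF matrix_exp_comp_has_vector_derivative [OF assms] has_vector_derivative_const]
  by (simp add: matrix_vector_mul_assoc)

text \<open>For fixed \<open>s\<close> the product \<open>matrix_exp ((s + t) *\<^sub>R A) **
  matrix_exp (- t *\<^sub>R A)\<close> has derivative zero in \<open>t\<close>, because
  \<open>A\<close> commutes with its exponential, so it keeps its value at t = 0. The special case s
  = 0 says that the two exponentials of opposite sign are inverse to each other, and this moves the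
  second factor across.\<close>

lemma matrix_exp_add:
  fixes A :: "real^'n^'n"
  shows "matrix_exp ((s + t) *\<^sub>R A) = matrix_exp (s *\<^sub>R A) ** matrix_exp (t *\<^sub>R A)"
proof -
  have *: "matrix_exp ((s + t) *\<^sub>R A) ** matrix_exp (- t *\<^sub>R A) = matrix_exp (s *\<^sub>R A)" for s t
  proof -
    have "matrix_exp ((s + t) *\<^sub>R A) *v (matrix_exp (- t *\<^sub>R A) *v y) = matrix_exp (s *\<^sub>R A) *v y" for y
    proof -
      let ?f = "\<lambda>t. matrix_exp ((s + t) *\<^sub>R A) *v (matrix_exp (- t *\<^sub>R A) *v y)"
      have "(?f has_derivative (\<lambda>h. 0)) (at u within UNIV)" for u
      proof -
        have "(?f has_vector_derivative
          matrix_exp ((s + u) *\<^sub>R A) *v ((-1) *\<^sub>R (A ** matrix_exp (- u *\<^sub>R A)) *v y) +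
          (1 *\<^sub>R (A ** matrix_exp ((s + u) *\<^sub>R A))) *v (matrix_exp (- u *\<^sub>R A) *v y)) (at u)"
          by (rule has_vector_derivative_matrix_vector_mult
              matrix_exp_comp_has_vector_derivative matrix_exp_comp_vector
              has_vector_derivative_const | (auto intro!: derivative_eq_intros)[1])+
        also have "matrix_exp ((s + u) *\<^sub>R A) *v ((-1) *\<^sub>R (A ** matrix_exp (- u *\<^sub>R A)) *v y) +
          (1 *\<^sub>R (A ** matrix_exp ((s + u) *\<^sub>R A))) *v (matrix_exp (- u *\<^sub>R A) *v y) = 0"
          by (simp only: scaleR_matrix_vector_assoc [symmetric] matrix_vector_mult_scaleR)
            (simp add: matrix_exp_commute matrix_vector_mul_assoc matrix_mul_assoc)
        finally show ?thesis by (simp add: has_vector_derivative_def)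
      qed
      then have "?f t = ?f 0"
        using has_derivative_zero_unique [of UNIV ?f t 0] by auto
      then show ?thesis by simp
    qed
    then show ?thesis by (simp add: matrix_eq matrix_vector_mul_assoc)
  qed
  have inv: "matrix_exp (- t *\<^sub>R A) ** matrix_exp (t *\<^sub>R A) = mat 1"
    using * [of 0 "-t"] by simp
  have "matrix_exp ((s + t) *\<^sub>R A) = matrix_exp ((s + t) *\<^sub>R A) ** (matrix_exp (- t *\<^sub>R A) ** matrix_exp (t *\<^sub>R A))"
    unfolding inv by simp
  also have "\<dots> = matrix_exp (s *\<^sub>R A) ** matrix_exp (t *\<^sub>R A)"
    by (simp only: * matrix_mul_assoc)
  finally show ?thesis .
qed

section \<open>Matrices with imaginary spectrum\<close>

text \<open>Each root r contributes - 1 / r to the logarithmic derivative at 0, and this is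
  imaginary whenever r is. The induction splits off one root at a time.\<close>

lemma imaginary_roots_log_derivative:
  fixes p :: "complex poly"
  assumes "\<forall>s. poly p s = 0 \<longrightarrow> Re s = 0" and "poly p 0 \<noteq> 0"
  shows "Re (poly (pderiv p) 0 / poly p 0) = 0"
  using assms
proof (induction "degree p" arbitrary: p)
  case 0
  then show ?case by (auto simp: degree_eq_zeroE pderiv_pCons elim!: degree_eq_zeroE)
next
  case (Suc n)
  then obtain r where r: "poly p r = 0"
    using fundamental_theorem_of_algebra constant_degree by (metis nat.distinct(1))
  then obtain q where q: "p = [:-r, 1:] * q"
    by (auto simp: poly_eq_0_iff_dvd)
  have "q \<noteq> 0" "r \<noteq> 0" using Suc.prems q by auto
  then have "n = degree q" using Suc.hyps(2) q by (simp add: degree_mult_eq del: mult_pCons_left)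
  have "Re (poly (pderiv q) 0 / poly q 0) = 0"
    by (rule Suc.hyps(1)) (use \<open>n = degree q\<close> Suc.prems q in auto)
  moreover have "poly (pderiv p) 0 / poly p 0 = - (1 / r) + poly (pderiv q) 0 / poly q 0"
  proof -
    have "pderiv p = [:-r, 1:] * pderiv q + q"
      unfolding q by (simp only: pderiv_mult) (simp add: pderiv_pCons)
    then have "poly (pderiv p) 0 = - r * poly (pderiv q) 0 + poly q 0"
      by simp
    moreover have "poly p 0 = - r * poly q 0"
      by (simp add: q)
    ultimately show ?thesis
      using \<open>r \<noteq> 0\<close> Suc.prems(2) by (simp add: field_simps)
  qed
  moreover have "Re r = 0" using Suc.prems r by auto
  then have "Re (1 / r) = 0" by (simp add: Re_divide)
  ultimately show ?case by simp
qed

lemma trace_eq_0: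
  fixes A :: "real^'n^'n"
  assumes spectrum: "\<forall>\<mu>. complex_eigenvalue A \<mu> \<longrightarrow> Re \<mu> = 0"
  shows "trace A = 0"
proof -
  let ?A = "map_matrix complex_of_real A"
  let ?M = "\<lambda>s. (\<chi> i j. (if i = j then 1 else 0) + s * complex_of_real (A $ i $ j)) :: complex^'n^'n"
  \<comment> \<open>\<open>p(s) = det (1 + s A)\<close> has linear coefficient \<open>trace A\<close> and its roots are the \<open>-1 / \<mu>\<close>.\<close>
  define M where "M = (\<chi> i j. [:if i = j then 1 else 0, complex_of_real (A $ i $ j):])"
  define p where "p = det M"
  have poly_p: "poly p s = det (?M s)" for s
    by (simp add: p_def M_def det_def poly_sum poly_prod)
  have p0: "poly p 0 = 1"
    using det_I [where 'a = complex and 'n = 'n] by (simp add: poly_p mat_def)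
  have "Re s = 0" if "poly p s = 0" for s
  proof -
    have "s \<noteq> 0" using that p0 by auto
    have "\<not> invertible (?M s)"
      using that by (simp add: poly_p invertible_det_nz)
    then obtain v where v: "v \<noteq> 0" "(?M s) *v v = 0"
      by (auto simp: invertible_left_inverse matrix_left_invertible_ker)
    have "?M s *v v = mat 1 *v v + (\<chi> i j. s * complex_of_real (A $ i $ j)) *v v"
      by (simp only: matrix_vector_mult_add_rdistrib [symmetric]) (simp add: mat_def vec_eq_iff plus_vec_def)
    also have "(\<chi> i j. s * complex_of_real (A $ i $ j)) *v v = s *s (?A *v v)"
      by (simp add: vec_eq_iff matrix_vector_mult_def map_matrix_def sum_distrib_left mult.assoc)
    finally have "?M s *v v = v + s *s (?A *v v)" by simp
    then have "s *s (?A *v v) = - v"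
      using v(2) by (simp add: eq_neg_iff_add_eq_0 add.commute)
    then have "?A *v v = (- 1 / s) *s v"
      using \<open>s \<noteq> 0\<close> by (simp add: vec_eq_iff field_simps)
    then have "Re (- 1 / s) = 0"
      using v(1) spectrum unfolding complex_eigenvalue_def by blast
    then show ?thesis
      by (cases "Re s = 0") (simp_all add: Re_divide)
  qed
  then have "Re (poly (pderiv p) 0 / poly p 0) = 0"
    by (intro imaginary_roots_log_derivative) (auto simp: p0)
  moreover have "poly (pderiv p) 0 = complex_of_real (trace A)"
  proof -
    let ?d = "\<lambda>j k :: 'n. if j = k then 1 else 0 :: complex"
    have "poly (pderiv p) 0 = (\<Sum>\<pi> | \<pi> permutes (UNIV :: 'n set). of_int (sign \<pi>) *
        (\<Sum>i\<in>UNIV. of_real (A $ i $ \<pi> i) * (\<Prod>j\<in>UNIV - {i}. ?d j (\<pi> j))))"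
      by (simp add: p_def M_def det_def higher_pderiv_sum [where n = 1, simplified] pderiv_mult
          pderiv_prod poly_sum poly_prod pderiv_pCons)
        (simp add: of_int_poly pderiv_pCons)
    also have "\<dots> = (\<Sum>\<pi>\<in>{id :: 'n \<Rightarrow> 'n}. of_int (sign \<pi>) *
        (\<Sum>i\<in>UNIV. of_real (A $ i $ \<pi> i) * (\<Prod>j\<in>UNIV - {i}. ?d j (\<pi> j))))"
    proof (rule sum.mono_neutral_right)
      show "\<forall>\<pi>\<in>{\<pi>. \<pi> permutes (UNIV :: 'n set)} - {id}. of_int (sign \<pi>) *
        (\<Sum>i\<in>UNIV. of_real (A $ i $ \<pi> i) * (\<Prod>j\<in>UNIV - {i}. ?d j (\<pi> j))) = 0"
      proof
        fix \<pi> :: "'n \<Rightarrow> 'n"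
        assume "\<pi> \<in> {\<pi>. \<pi> permutes UNIV} - {id}"
        then have \<pi>: "\<pi> permutes UNIV" "\<pi> \<noteq> id" by auto
        obtain k where k: "\<pi> k \<noteq> k" using \<pi> by (auto simp: fun_eq_iff)
        then have \<pi>k: "\<pi> (\<pi> k) \<noteq> \<pi> k" using permutes_inj [OF \<pi>(1)] by (auto dest: injD)
        \<comment> \<open>The product rule removes a single factor i, but a permutation other than
          the identity moves at least two points, k and \<pi> k. One of them differs from i and
          leaves an off-diagonal zero in the product.\<close>
        have prod_0: "(\<Prod>j\<in>UNIV - {i}. ?d j (\<pi> j)) = 0" for i
        proof (rule prod_zero)
          show "\<exists>j\<in>UNIV - {i}. ?d j (\<pi> j) = 0"
          proof (cases "k = i")
            case True
            then show ?thesis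
              using k \<pi>k by (intro bexI [of _ "\<pi> k"]) simp_all
          next
            case False
            then show ?thesis
              using k by (intro bexI [of _ k]) simp_all
          qed
        qed simp
        show "of_int (sign \<pi>) *
          (\<Sum>i\<in>UNIV. of_real (A $ i $ \<pi> i) * (\<Prod>j\<in>UNIV - {i}. ?d j (\<pi> j))) = 0"
          by (simp only: prod_0 mult_zero_right sum.neutral_const)
      qed
    qed (simp_all add: finite_permutations permutes_id)
    also have "\<dots> = complex_of_real (trace A)"
      by (simp add: trace_def)
    finally show ?thesis .
  qed
  \<comment> \<open>The trace is real, so the vanishing of its real part suffices.\<close>
  ultimately show ?thesis by (simp add: p0)
qed

declare transpose_matrix_vector [simp del]

section \<open>Solutions of the Riccati equation\<close>

abbreviation quadratic_form :: "real^'n^'n \<Rightarrow> real^'n \<Rightarrow> real" where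
  "quadratic_form P v \<equiv> v \<bullet> (P *v v)"

lemma quadratic_form_le:
  assumes "norm (P *v v) \<le> p * norm v"
  shows "quadratic_form P v \<le> p * (norm v)\<^sup>2"
proof -
  have "quadratic_form P v \<le> norm v * norm (P *v v)"
    by (rule norm_cauchy_schwarz)
  also have "\<dots> \<le> norm v * (p * norm v)"
    by (intro mult_left_mono assms norm_ge_zero)
  finally show ?thesis by (simp add: power2_eq_square mult_ac)
qed

lemma inner_transpose_mult: "(transpose M *v x) \<bullet> y = x \<bullet> (M *v y)"
  for M :: "real^'n^'m"
  by (metis dot_lmul_matrix transpose_matrix_vector)

lemma positive_definite_inner_commute:
  assumes "positive_definite P"
  shows "(P *v x) \<bullet> y = x \<bullet> (P *v y)"
  using assms inner_transpose_mult [of P x y] by (simp add: positive_definite_def)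

lemma positive_definite_nonneg: "positive_definite P \<Longrightarrow> 0 \<le> quadratic_form P v"
  by (cases "v = 0") (auto simp: positive_definite_def less_imp_le)

text \<open>The form is nonnegative at \<open>y\<close> minus its \<open>P\<close>-orthogonal
  projection onto \<open>x\<close>; scaling that vector by the value of the form at \<open>x\<close>
  avoids the division.\<close>

lemma positive_definite_Cauchy_Schwarz:
  assumes "positive_definite P"
  shows "(x \<bullet> (P *v y))\<^sup>2 \<le> quadratic_form P x * quadratic_form P y"
proof (cases "x = 0")
  case False
  let ?q = "quadratic_form P" and ?a = "x \<bullet> (P *v y)"
  have "0 \<le> ?q (?q x *\<^sub>R y - ?a *\<^sub>R x)"
    by (rule positive_definite_nonneg [OF assms])
  also have "\<dots> = ?q x * (?q x * ?q y - ?a\<^sup>2)"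
    using positive_definite_inner_commute [OF assms, of y x]
    by (simp add: matrix_vector_mult_diff_distrib matrix_vector_mult_scaleR inner_diff_left
        inner_diff_right algebra_simps power2_eq_square inner_commute)
  finally show ?thesis
    using False assms by (simp add: positive_definite_def zero_le_mult_iff not_le [symmetric])
qed simp

text \<open>The parallelogram identity with the term for \<open>x - y\<close> dropped.\<close>

lemma positive_definite_add_le:
  assumes "positive_definite P"
  shows "quadratic_form P (x + y) \<le> 2 * quadratic_form P x + 2 * quadratic_form P y"
  using positive_definite_nonneg [OF assms, of "x - y"]
  by (simp add: matrix_vector_mult_diff_distrib matrix_vector_right_distrib inner_diff_left
      inner_diff_right inner_add_left inner_add_right)

lemma positive_definite_invertible:
  assumes "positive_definite P"
  shows "invertible P"
proof -
  have "x = 0" if "P *v x = 0" for x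
    using assms that by (force simp: positive_definite_def)
  then show ?thesis
    by (simp add: invertible_left_inverse matrix_left_invertible_ker)
qed

lemma positive_definite_lower_bound:
  fixes P :: "real^'a^'a"
  assumes "positive_definite P"
  obtains c where "c > 0" "\<And>v. c * (norm v)\<^sup>2 \<le> quadratic_form P v"
proof -
  have "continuous_on (sphere 0 1) (quadratic_form P)"
    by (intro continuous_intros linear_continuous_on matrix_vector_mul_bounded_linear)
  moreover have "sphere (0 :: real^'a) 1 \<noteq> {}"
    by (simp add: sphere_eq_empty)
  ultimately obtain w where w: "w \<in> sphere 0 1"
      "\<And>v. v \<in> sphere 0 1 \<Longrightarrow> quadratic_form P w \<le> quadratic_form P v"
    using continuous_attains_inf [OF compact_sphere] by blast
  show ?thesis
  proof (rule that)
    show "quadratic_form P w > 0"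
    proof -
      have "w \<noteq> 0" using w(1) by auto
      then show ?thesis using assms by (simp add: positive_definite_def)
    qed
    show "quadratic_form P w * (norm v)\<^sup>2 \<le> quadratic_form P v" for v
    proof (cases "v = 0")
      case False
      then have "quadratic_form P w \<le> quadratic_form P (inverse (norm v) *\<^sub>R v)"
        by (intro w) simp
      then show ?thesis
        using False by (simp add: matrix_vector_mult_scaleR field_simps power2_eq_square)
    qed simp
  qed
qed

section \<open>Energy and trace identities from the Riccati equation\<close>

lemma matrix_vector_mult_minus: "(- M) *v v = - (M *v v)" for M :: "real^'n^'m"
  by (simp add: vec_eq_iff matrix_vector_mult_def sum_negf)

text \<open>The left-hand side is the derivative of the quadratic form along x' = A x. The identity
  is used in three roles: along the closed loop, along the backward flow, and at
  \<open>W *v q t\<close> for the inverse \<open>W\<close> of \<open>P\<close>.\<close>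

lemma riccati_quadratic_form:
  assumes "positive_definite P" and "riccati A B \<gamma> P"
  shows "2 * ((P *v v) \<bullet> (A *v v)) = (norm (transpose B *v (P *v v)))\<^sup>2 - \<gamma> * quadratic_form P v"
proof -
  have eq: "(transpose A ** P + P ** A - P ** B ** transpose B ** P) *v v = - (\<gamma> *\<^sub>R (P *v v))"
    using assms(2) by (simp add: riccati_def matrix_vector_mult_minus flip: scaleR_matrix_vector_assoc)
  have "v \<bullet> (transpose A *v (P *v v)) + v \<bullet> (P *v (A *v v))
      - v \<bullet> (P *v (B *v (transpose B *v (P *v v)))) = - \<gamma> * quadratic_form P v"
    using arg_cong [OF eq, of "(\<bullet>) v"]
    by (simp add: matrix_vector_mult_diff_rdistrib matrix_vector_mult_add_rdistrib
        inner_add_right inner_diff_right matrix_vector_mul_assoc [symmetric])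
  moreover have "v \<bullet> (transpose A *v (P *v v)) = (P *v v) \<bullet> (A *v v)"
    by (metis inner_commute inner_transpose_mult)
  moreover have "v \<bullet> (P *v (A *v v)) = (P *v v) \<bullet> (A *v v)"
    by (simp add: positive_definite_inner_commute [OF assms(1)])
  moreover have "v \<bullet> (P *v (B *v (transpose B *v (P *v v)))) = (norm (transpose B *v (P *v v)))\<^sup>2"
    by (simp add: power2_norm_eq_inner inner_transpose_mult positive_definite_inner_commute [OF assms(1)])
  ultimately show ?thesis by simp
qed

text \<open>Multiplied on the right by the inverse of \<open>P\<close>, the equation contains
  \<open>A\<close> only as its transpose and as a matrix similar to \<open>A\<close>, both of trace
  zero. What remains equates the trace of the quadratic term with that of \<gamma> times the
  identity.\<close>

lemma riccati_trace:
  fixes A P :: "real^'n^'n" and B :: "real^'m^'n"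
  assumes "positive_definite P" and "riccati A B \<gamma> P" and "trace A = 0"
  shows "trace (transpose B ** P ** B) = \<gamma> * CARD('n)"
proof -
  obtain W where W: "P ** W = mat 1" "W ** P = mat 1"
    using positive_definite_invertible [OF assms(1)] by (auto simp: invertible_def)
  have "trace ((transpose A ** P + P ** A - P ** B ** transpose B ** P) ** W) = trace (- (\<gamma> *\<^sub>R P) ** W)"
    using assms(2) by (simp add: riccati_def)
  also have "- (\<gamma> *\<^sub>R P) ** W = (- \<gamma>) *\<^sub>R mat 1"
    by (metis W(1) scalar_matrix_assoc scaleR_minus_left)
  also have "trace ((- \<gamma>) *\<^sub>R mat 1 :: real^'n^'n) = - \<gamma> * CARD('n)"
    by (simp add: trace_def mat_def)
  also have "(transpose A ** P + P ** A - P ** B ** transpose B ** P) ** W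
      = transpose A + P ** A ** W - P ** B ** transpose B"
    by (simp add: matrix_eq matrix_vector_mult_add_rdistrib matrix_vector_mult_diff_rdistrib
        flip: matrix_vector_mul_assoc)
      (simp add: matrix_vector_mul_assoc W)
  finally have "trace (transpose A) + trace (P ** A ** W) - trace (P ** B ** transpose B) = - \<gamma> * CARD('n)"
    by (simp add: trace_add trace_sub)
  moreover have "trace (transpose A) = 0"
    using assms(3) by (simp add: trace_def transpose_def)
  moreover have "trace (P ** A ** W) = 0"
    using assms(3) trace_mul_sym [of "P ** A" W] by (simp add: matrix_mul_assoc W)
  moreover have "trace (P ** B ** transpose B) = trace (transpose B ** P ** B)"
    using trace_mul_sym [of "P ** B" "transpose B"] by (simp add: matrix_mul_assoc)
  ultimately show ?thesis by simp
qed

text \<open>The components of the feedback are \<open>P\<close>-inner products of \<open>v\<close>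
  with the columns of \<open>B\<close>. Cauchy-Schwarz applies to each of them, and the forms of the
  columns add up to the trace computed in \<open>riccati_trace\<close>. Every factor \<gamma> gained
  later from \<open>F\<close> comes from here.\<close>

lemma riccati_feedback_bound:
  fixes A P :: "real^'n^'n" and B :: "real^'m^'n"
  assumes P: "positive_definite P" and "riccati A B \<gamma> P" and "trace A = 0"
  shows "(norm (transpose B *v (P *v v)))\<^sup>2 \<le> \<gamma> * CARD('n) * quadratic_form P v"
proof -
  have comp: "(transpose B *v w) $ j = column j B \<bullet> w" for w j
    by (simp add: matrix_vector_mult_def transpose_def column_def inner_vec_def)
  have "(norm (transpose B *v (P *v v)))\<^sup>2 = (\<Sum>j\<in>UNIV. (column j B \<bullet> (P *v v))\<^sup>2)"
    unfolding power2_norm_eq_inner inner_vec_def [of "transpose B *v _"] comp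
    by (simp add: power2_eq_square)
  also have "\<dots> \<le> (\<Sum>j\<in>UNIV. quadratic_form P (column j B) * quadratic_form P v)"
    by (intro sum_mono positive_definite_Cauchy_Schwarz P)
  also have "\<dots> = (\<Sum>j\<in>UNIV. quadratic_form P (column j B)) * quadratic_form P v"
    by (simp add: sum_distrib_right)
  also have "(\<Sum>j\<in>UNIV. quadratic_form P (column j B)) = trace (transpose B ** P ** B)"
  proof -
    have "(transpose B ** P ** B) $ j $ j = quadratic_form P (column j B)" for j
    proof -
      have "(transpose B ** (P ** B)) $ j $ j = (transpose B *v (P *v column j B)) $ j"
        by (simp add: matrix_matrix_mult_def matrix_vector_mult_def column_def)
      then show ?thesis by (simp add: comp matrix_mul_assoc)
    qed
    then show ?thesis by (simp add: trace_def)
  qed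
  finally show ?thesis
    using riccati_trace [OF assms] by simp
qed

section \<open>The controllability Gramian\<close>

lemma continuous_on_matrix_vector_mult [continuous_intros]:
  fixes f :: "'a::topological_space \<Rightarrow> real^'n^'m"
  assumes "continuous_on S f" "continuous_on S g"
  shows "continuous_on S (\<lambda>x. f x *v g x)"
  by (rule bounded_bilinear.continuous_on [OF bounded_bilinear_matrix_vector_mult assms])

lemma continuous_on_matrix_exp:
  assumes "continuous_on S f"
  shows "continuous_on S (\<lambda>x. matrix_exp (f x *\<^sub>R A))"
proof -
  have "continuous_on UNIV (\<lambda>t. matrix_exp (t *\<^sub>R A))"
    by (intro continuous_at_imp_continuous_on ballI
        has_vector_derivative_continuous [OF matrix_exp_has_vector_derivative])
  from continuous_on_compose2 [OF this assms] show ?thesis by simp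
qed

text \<open>The curve q solves the adjoint equation q' = - A^T q, so along any controlled trajectory
  the derivative of q . x is (B^T q) . u = 0. Steering from \<open>y\<close> to 0 turns the
  constancy of q . x into |y|^2 = 0. The hypothesis covers all t \<ge> 0 because the transfer time
  is not known in advance.\<close>

lemma controllable_observable:
  assumes "controllable A B"
    and zero: "\<And>t. t \<ge> 0 \<Longrightarrow> transpose B *v (matrix_exp (- t *\<^sub>R transpose A) *v y) = 0"
  shows "y = 0"
proof -
  obtain T u x where T: "T > 0" "x 0 = y" "x T = 0"
    and x: "\<And>t. t \<in> {0..T} \<Longrightarrow> (x has_vector_derivative (A *v x t + B *v u t)) (at t within {0..T})"
    using assms(1) [unfolded controllable_def, rule_format, of y 0] by blast
  let ?q = "\<lambda>t. matrix_exp (- t *\<^sub>R transpose A) *v y"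
  have "((\<lambda>t. ?q t \<bullet> x t) has_vector_derivative 0) (at t within {0..T})" if t: "t \<in> {0..T}" for t
  proof -
    have "(?q has_vector_derivative (-1 *\<^sub>R (transpose A ** matrix_exp (- t *\<^sub>R transpose A))) *v y) (at t within {0..T})"
      by (rule matrix_exp_comp_vector) (auto intro!: derivative_eq_intros)
    then have "(?q has_vector_derivative - (transpose A *v ?q t)) (at t within {0..T})"
      by (simp add: matrix_vector_mult_minus matrix_vector_mul_assoc)
    from bounded_bilinear.has_vector_derivative [OF bounded_bilinear_inner this x [OF t]]
    show ?thesis
    proof (rule has_vector_derivative_eq_rhs)
      show "?q t \<bullet> (A *v x t + B *v u t) + - (transpose A *v ?q t) \<bullet> x t = 0"
        using zero [of t] t inner_transpose_mult [of B "?q t" "u t"]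
        by (simp add: inner_transpose_mult inner_add_right)
    qed
  qed
  then obtain c where "?q t \<bullet> x t = c" if "t \<in> {0..T}" for t
    using has_vector_derivative_zero_constant [where f = "\<lambda>t. ?q t \<bullet> x t" and s = "{0..T}"] by auto
  from this [of 0] this [of T] show ?thesis
    using T by simp
qed

text \<open>Controllability allows a transfer time that depends on the endpoints, so a common
  horizon has to be produced. Every nonzero \<open>y\<close> is detected on some horizon k; the sets
  where \<open>g k\<close> is positive are open, increase with k and cover the unit sphere, and
  compactness leaves one horizon. The constant is the minimum of the Gramian form over the sphere at
  that horizon.\<close>

lemma controllable_gramian:
  fixes A :: "real^'n^'n" and B :: "real^'m^'n"
  assumes "controllable A B"
  obtains T c where "T > 0" "c > 0"
    "\<And>y. c * (norm y)\<^sup>2 \<le> integral {0..T} (\<lambda>t. (norm (transpose B *v (matrix_exp (- t *\<^sub>R transpose A) *v y)))\<^sup>2)"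
proof -
  define h where "h = (\<lambda>y t. (norm (transpose B *v (matrix_exp (- t *\<^sub>R transpose A) *v y)))\<^sup>2)"
  define g where "g = (\<lambda>k y. integral {0..real k} (h y))"
  have cont_h: "continuous_on S (h y)" for S y
    unfolding h_def by (intro continuous_intros continuous_on_matrix_exp)
  have h_nonneg: "0 \<le> h y t" for y t
    by (simp add: h_def)
  have cont_g: "continuous_on S (g k)" for S k
  proof -
    have "continuous_on (S \<times> cbox 0 (real k)) (\<lambda>(y, t). h y t)"
      unfolding h_def case_prod_unfold by (intro continuous_intros continuous_on_matrix_exp)
    from integral_continuous_on_param [OF this] show ?thesis
      by (simp add: g_def)
  qed
  have mono: "g k y \<le> g l y" if "k \<le> l" for k l y
    unfolding g_def using that
    by (intro integral_subset_le integrable_continuous_real cont_h) (auto simp: h_def)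
  have pos: "\<exists>k. g k y > 0" if "y \<noteq> 0" for y
  proof (rule ccontr)
    assume neg: "\<not> ?thesis"
    have "transpose B *v (matrix_exp (- t *\<^sub>R transpose A) *v y) = 0" if "t \<ge> 0" for t
    proof -
      obtain k where k: "t < real k" using reals_Archimedean2 by blast
      have "g k y \<ge> 0"
        unfolding g_def by (intro integral_nonneg integrable_continuous_real cont_h) (auto simp: h_def)
      moreover have "\<not> 0 < g k y" using neg by blast
      ultimately have "g k y = 0" by linarith
      then have "\<forall>s\<in>{0..real k}. h y s = 0"
        using integral_eq_0_iff [OF cont_h, of 0 "real k" y] h_nonneg k that by (simp add: g_def)
      then have "h y t = 0"
        using k that by simp
      then show ?thesis by (simp add: h_def)
    qed
    with controllable_observable [OF assms] that show False by blast
  qed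
  have "sphere 0 1 \<subseteq> (\<Union>k\<in>UNIV. {y. 0 < g k y})"
  proof
    fix y :: "real^'n"
    assume "y \<in> sphere 0 1"
    then have "y \<noteq> 0" by auto
    with pos show "y \<in> (\<Union>k\<in>UNIV. {y. 0 < g k y})" by blast
  qed
  then obtain C where C: "finite C" "sphere 0 1 \<subseteq> (\<Union>k\<in>C. {y. 0 < g k y})"
    using compactE_image [OF compact_sphere, of UNIV "\<lambda>k. {y. 0 < g k y}"]
      open_Collect_less [OF continuous_on_const cont_g] by metis
  \<comment> \<open>Inserting 0 keeps \<open>Max\<close> away from the empty set, and
    \<open>Suc\<close> makes the horizon positive.\<close>
  define K where "K = Suc (Max (insert 0 C))"
  have K: "g K y > 0" if y: "y \<in> sphere 0 1" for y
  proof -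
    obtain k where "k \<in> C" "g k y > 0" using C(2) y by blast
    moreover have "k \<le> K" using C \<open>k \<in> C\<close> by (simp add: K_def le_SucI)
    ultimately show ?thesis using mono [of k K y] by linarith
  qed
  have "sphere (0 :: real^'n) 1 \<noteq> {}"
    by (simp add: sphere_eq_empty)
  then obtain w where w: "w \<in> sphere 0 1" "\<And>v. v \<in> sphere 0 1 \<Longrightarrow> g K w \<le> g K v"
    using continuous_attains_inf [OF compact_sphere _ cont_g] by blast
  show ?thesis
  proof (rule that)
    show "real K > 0" by (simp add: K_def)
    show "g K w > 0" using K w by blast
    show "g K w * (norm y)\<^sup>2 \<le> integral {0..real K} (\<lambda>t. (norm (transpose B *v (matrix_exp (- t *\<^sub>R transpose A) *v y)))\<^sup>2)" for y
    proof (cases "y = 0")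
      case False
      have scale: "h y = (\<lambda>t. (norm y)\<^sup>2 * h (inverse (norm y) *\<^sub>R y) t)"
        using False by (simp add: h_def matrix_vector_mult_scaleR power_mult_distrib field_simps)
      have eq: "g K y = (norm y)\<^sup>2 * g K (inverse (norm y) *\<^sub>R y)"
        unfolding g_def by (subst scale) simp
      have le: "g K w \<le> g K (inverse (norm y) *\<^sub>R y)"
        using False by (intro w) simp
      have "g K w * (norm y)\<^sup>2 \<le> g K y"
        unfolding eq by (subst mult.commute) (intro mult_left_mono le zero_le_power2)
      then show ?thesis by (simp add: g_def h_def)
    qed simp
  qed
qed

text \<open>With W the inverse of \<open>P\<close> and q the adjoint curve from y = P v, the
  function e^(- \<gamma> t) q . W q has derivative - e^(- \<gamma> t) |B^T q|^2. Integrating over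
  the Gramian horizon and dropping the nonnegative end value bounds the weighted Gramian form of y
  by y . W y = y . v. Since that form is at least a fixed multiple of |y|^2, one factor |y|
  cancels.\<close>

lemma riccati_bound:
  fixes A :: "real^'n^'n" and B :: "real^'m^'n"
  assumes "controllable A B"
  obtains p where "p > 0"
    "\<And>\<gamma> P v. 0 < \<gamma> \<Longrightarrow> \<gamma> \<le> 1 \<Longrightarrow> positive_definite P \<Longrightarrow> riccati A B \<gamma> P \<Longrightarrow> norm (P *v v) \<le> p * norm v"
proof -
  obtain T c where T: "T > 0" and c: "c > 0"
    and gram: "\<And>y. c * (norm y)\<^sup>2 \<le> integral {0..T} (\<lambda>t. (norm (transpose B *v (matrix_exp (- t *\<^sub>R transpose A) *v y)))\<^sup>2)"
    using controllable_gramian [OF assms] by metis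
  show ?thesis
  proof (rule that)
    show "exp T / c > 0" using c by simp
    fix \<gamma> :: real and P v
    assume \<gamma>: "0 < \<gamma>" "\<gamma> \<le> 1" and P: "positive_definite P" and ric: "riccati A B \<gamma> P"
    obtain W where W: "P ** W = mat 1" "W ** P = mat 1"
      using positive_definite_invertible [OF P] by (auto simp: invertible_def)
    define y where "y = P *v v"
    define q where "q = (\<lambda>t. matrix_exp (- t *\<^sub>R transpose A) *v y)"
    define f where "f = (\<lambda>t. exp (- \<gamma> * t) * (q t \<bullet> (W *v q t)))"
    let ?h = "\<lambda>t. (norm (transpose B *v q t))\<^sup>2"
    have PW: "P *v (W *v z) = z" for z
      by (simp add: matrix_vector_mul_assoc W)
    have W_form: "z \<bullet> (W *v z) = quadratic_form P (W *v z)" for z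
      by (simp add: PW inner_commute)
    have W_sym: "z \<bullet> (W *v z') = (W *v z) \<bullet> z'" for z z'
      by (metis PW positive_definite_inner_commute [OF P])
    have q': "(q has_vector_derivative - (transpose A *v q t)) (at t within S)" for t S
    proof -
      have "(q has_vector_derivative (-1 *\<^sub>R (transpose A ** matrix_exp (- t *\<^sub>R transpose A))) *v y) (at t within S)"
        unfolding q_def by (rule matrix_exp_comp_vector) (auto intro!: derivative_eq_intros)
      then show ?thesis
        by (simp add: matrix_vector_mult_minus matrix_vector_mul_assoc q_def)
    qed
    have f': "(f has_vector_derivative - (exp (- \<gamma> * t) * ?h t)) (at t within S)" for t S
    proof -
      have Wq: "((\<lambda>t. W *v q t) has_vector_derivative W *v - (transpose A *v q t)) (at t within S)"
        by (rule bounded_linear.has_vector_derivative [OF matrix_vector_mul_bounded_linear q'])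
      have e: "((\<lambda>t. exp (- \<gamma> * t)) has_vector_derivative - \<gamma> * exp (- \<gamma> * t)) (at t within S)"
        unfolding has_real_derivative_iff_has_vector_derivative [symmetric]
        by (auto intro!: derivative_eq_intros)
      have "2 * (q t \<bullet> (A *v (W *v q t))) = ?h t - \<gamma> * (q t \<bullet> (W *v q t))"
        using riccati_quadratic_form [OF P ric, of "W *v q t"]
        by (simp add: PW inner_commute)
      moreover have "q t \<bullet> (W *v (transpose A *v q t)) = q t \<bullet> (A *v (W *v q t))"
        by (metis W_sym inner_commute inner_transpose_mult)
      moreover have "(transpose A *v q t) \<bullet> (W *v q t) = q t \<bullet> (A *v (W *v q t))"
        by (simp add: inner_transpose_mult)
      ultimately have eq: "q t \<bullet> (W *v (transpose A *v q t)) + (transpose A *v q t) \<bullet> (W *v q t)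
          = ?h t - \<gamma> * (q t \<bullet> (W *v q t))"
        by simp
      have neg: "W *v - z = - (W *v z)" for z
        using matrix_vector_mult_scaleR [of W "-1" z] by simp
      from bounded_bilinear.has_vector_derivative [OF bounded_bilinear_mult e
          bounded_bilinear.has_vector_derivative [OF bounded_bilinear_inner q' Wq]]
      show ?thesis unfolding f_def
      proof (rule has_vector_derivative_eq_rhs)
        show "exp (- \<gamma> * t) * (q t \<bullet> (W *v - (transpose A *v q t)) + - (transpose A *v q t) \<bullet> (W *v q t)) +
          - \<gamma> * exp (- \<gamma> * t) * (q t \<bullet> (W *v q t)) = - (exp (- \<gamma> * t) * ?h t)"
          using arg_cong [OF eq, of "\<lambda>x. exp (- \<gamma> * t) * x"]
          by (simp add: neg algebra_simps)
      qed
    qed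
    have cont_q: "continuous_on S q" for S
      unfolding q_def by (intro continuous_intros continuous_on_matrix_exp)
    have "((\<lambda>t. - (exp (- \<gamma> * t) * ?h t)) has_integral f T - f 0) {0..T}"
      by (rule fundamental_theorem_of_calculus) (use T f' in auto)
    from has_integral_neg [OF this]
    have int: "((\<lambda>t. exp (- \<gamma> * t) * ?h t) has_integral f 0 - f T) {0..T}"
      by simp
    have "exp (- T) * integral {0..T} ?h = integral {0..T} (\<lambda>t. exp (- T) * ?h t)"
      by simp
    \<comment> \<open>The bound \<gamma> \<le> 1 enters here: it allows the weight to be replaced by
      its smallest possible value exp (- T), which does not depend on \<gamma>.\<close>
    also have "\<dots> \<le> integral {0..T} (\<lambda>t. exp (- \<gamma> * t) * ?h t)"
    proof (rule integral_le)
      show "(\<lambda>t. exp (- T) * ?h t) integrable_on {0..T}"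
        by (intro integrable_continuous_real continuous_intros cont_q)
      show "exp (- T) * ?h t \<le> exp (- \<gamma> * t) * ?h t" if "t \<in> {0..T}" for t
        using mult_mono [of \<gamma> 1 t T] that \<gamma> by (intro mult_right_mono) auto
    qed (use int in auto)
    also have "\<dots> = f 0 - f T"
      using int by (rule integral_unique)
    also have "\<dots> \<le> f 0"
      unfolding f_def W_form using positive_definite_nonneg [OF P] by simp
    also have "f 0 = y \<bullet> v"
      by (simp add: f_def q_def y_def matrix_vector_mul_assoc W)
    finally have upper: "exp (- T) * integral {0..T} ?h \<le> y \<bullet> v" .
    have "exp (- T) * (c * (norm y)\<^sup>2) \<le> exp (- T) * integral {0..T} ?h"
      unfolding q_def by (intro mult_left_mono gram) simp
    also note upper
    also have "y \<bullet> v \<le> norm y * norm v"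
      by (rule norm_cauchy_schwarz)
    finally have "norm y * (c * norm y) \<le> norm y * (exp T * norm v)"
      by (simp add: exp_minus field_simps power2_eq_square)
    then have "c * norm y \<le> exp T * norm v"
      by (cases "y = 0") auto
    then show "norm (P *v v) \<le> exp T / c * norm v"
      using c by (simp add: y_def field_simps)
  qed
qed

section \<open>Decay of a delay Lyapunov functional\<close>

text \<open>Gronwall's inequality by the integrating factor exp (- c t) and the mean value theorem.
  The sign of \<open>c\<close> is free: it serves both for decay of the functional and for growth
  bounds of flows.\<close>

lemma differential_inequality_exp:
  fixes f :: "real \<Rightarrow> real"
  assumes "a \<le> b"
    and f': "\<And>t. t \<in> {a..b} \<Longrightarrow> (f has_real_derivative f' t) (at t within {a..b})"
    and le: "\<And>t. t \<in> {a..b} \<Longrightarrow> f' t \<le> c * f t"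
  shows "f b \<le> exp (c * (b - a)) * f a"
proof (cases "a < b")
  case True
  let ?g = "\<lambda>t. exp (- c * t) * f t"
  have "(?g has_derivative (*) (exp (- c * t) * (f' t - c * f t))) (at t within {a..b})" if "t \<in> {a..b}" for t
    unfolding has_field_derivative_def [symmetric] using f' [OF that]
    by (auto intro!: derivative_eq_intros simp: algebra_simps)
  then obtain x where "x \<in> {a<..<b}" "?g b - ?g a = exp (- c * x) * (f' x - c * f x) * (b - a)"
    using mvt_simple [OF True, of ?g "\<lambda>t. (*) (exp (- c * t) * (f' t - c * f t))"] by auto
  moreover have "exp (- c * x) * (f' x - c * f x) * (b - a) \<le> 0"
    using le [of x] True calculation(1)
    by (intro mult_nonpos_nonneg mult_nonneg_nonpos) auto
  ultimately have "exp (- c * b) * f b \<le> exp (- c * a) * f a"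
    by simp
  then have "exp (c * b) * (exp (- c * b) * f b) \<le> exp (c * b) * (exp (- c * a) * f a)"
    by (rule mult_left_mono) simp
  moreover have "exp (c * b) * (exp (- c * x) * y) = exp (c * (b - x)) * y" for x y
    by (simp add: right_diff_distrib exp_diff exp_minus field_simps)
  ultimately show ?thesis
    by (simp only: diff_self mult_zero_right exp_zero mult_1)
qed (use assms(1) in auto)

section \<open>Integrals with moving endpoints and the Lyapunov-Krasovskii functional\<close>

lemma integral_has_vector_derivative_atLeast:
  fixes f :: "real \<Rightarrow> 'a::banach"
  assumes "continuous_on {a..} f" and "a \<le> x"
  shows "((\<lambda>u. integral {a..u} f) has_vector_derivative f x) (at x within {a..})"
proof -
  have "((\<lambda>u. integral {a..u} f) has_vector_derivative f x) (at x within {a..x+1})"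
    by (rule integral_has_vector_derivative) (use assms in \<open>auto intro: continuous_on_subset\<close>)
  moreover have "at x within {a..x+1} = at x within {a..}"
    by (rule at_within_nhd [of _ "{..<x+1}"]) auto
  ultimately show ?thesis by simp
qed

lemma integral_atLeast_diff:
  fixes f :: "real \<Rightarrow> 'a::banach"
  assumes "continuous_on {a..} f" and "a \<le> s" "s \<le> t"
  shows "integral {a..t} f - integral {a..s} f = integral {s..t} f"
proof -
  have "f integrable_on {a..t}"
    by (rule integrable_continuous_real) (use assms in \<open>auto intro: continuous_on_subset\<close>)
  from Henstock_Kurzweil_Integration.integral_combine [OF _ _ this, of s] assms show ?thesis
    by (auto simp: algebra_simps)
qed

lemma has_vector_derivative_shift:
  assumes "(f has_vector_derivative f') (at (t - h) within S)" and "(\<lambda>t. t - h) ` S' \<subseteq> S"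
  shows "((\<lambda>t. f (t - h)) has_vector_derivative f') (at t within S')"
proof -
  have "((\<lambda>t. t - h) has_vector_derivative 1) (at t within S')"
    by (auto intro!: derivative_eq_intros)
  from vector_diff_chain_within [OF this] show ?thesis
    using has_vector_derivative_within_subset [OF assms] by (simp add: o_def)
qed

text \<open>A scalar abstraction of the closed loop: \<open>v\<close> stands for V(x),
  \<open>Z\<close> for V(z). The derivative of the functional \<open>L\<close> contains + v, coming
  from the memory terms and from \<open>decay\<close>; \<open>v_le\<close> trades it for terms of
  order \<gamma>^2 Z and \<gamma>^3 J. These are of higher order than the available \<gamma> Z and
  \<gamma>^2 J, and \<open>small1\<close> and \<open>small2\<close> say exactly that half units of
  the latter absorb them.\<close>

lemma delay_Lyapunov_decay:
  fixes v Z Z' J :: "real \<Rightarrow> real"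
  defines "k \<equiv> \<lambda>\<alpha>. 2 * \<alpha> + 1"
  assumes r: "0 \<le> r"
    and cont: "continuous_on {-r..} v" and v: "\<And>t. -r \<le> t \<Longrightarrow> 0 \<le> v t"
    and J: "\<And>t. J t = integral {t-r..t} v"
    and Z: "\<And>t. 0 \<le> t \<Longrightarrow> 0 \<le> Z t"
    and Z': "\<And>t. 0 \<le> t \<Longrightarrow> (Z has_real_derivative Z' t) (at t within {0..})"
    and decay: "\<And>t. 0 \<le> t \<Longrightarrow> Z' t \<le> - \<gamma> * Z t + \<alpha> * \<gamma>\<^sup>2 * (v t + J t)"
    and v_le: "\<And>t. 0 \<le> t \<Longrightarrow> v t \<le> 2 * Z t + \<beta> * \<gamma> * J t"
    and \<gamma>: "0 < \<gamma>" and \<alpha>: "0 \<le> \<alpha>" and \<beta>: "0 \<le> \<beta>"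
    and small1: "4 * (\<alpha> + k \<alpha> * (r + 1)) * \<gamma> \<le> 1"
    and small2: "2 * (\<alpha> + k \<alpha> * (r + 1)) * \<beta> * \<gamma> \<le> 1"
    and t: "0 \<le> t"
  shows "v t \<le> (2 + \<beta> / (k \<alpha> * \<gamma>)) * (exp (- min (\<gamma> / 2) (1 / (2 * k \<alpha> * (r + 1))) * t)
    * (Z 0 + k \<alpha> * \<gamma>\<^sup>2 * (r + 1) * J 0))"
proof -
  \<comment> \<open>With k = 2 \<alpha> + 1 the term - \<mu> J pays for the error \<alpha>
    \<gamma>^2 J and still leaves - (\<alpha> + 1) \<gamma>^2 J.\<close>
  define \<mu> where "\<mu> = k \<alpha> * \<gamma>\<^sup>2"
  \<comment> \<open>After absorption - (\<gamma> / 2) Z - (\<gamma>^2 / 2) J is left. The first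
    entry of the minimum serves Z; the second serves \<mu> (S + J), which is at most \<mu> (r + 1)
    J.\<close>
  define \<sigma> where "\<sigma> = min (\<gamma> / 2) (1 / (2 * k \<alpha> * (r + 1)))"
  define H where "H = (\<lambda>t. integral {-r..t} v)"
  define HH where "HH = (\<lambda>t. integral {-r..t} H)"
  \<comment> \<open>\<open>S t\<close> is the integral of \<open>(s - t + r) * v s\<close> over \<open>{t-r..t}\<close>; the extra \<open>J\<close> in \<open>L\<close> lets \<open>L\<close> dominate \<open>J\<close>.\<close>
  define S where "S = (\<lambda>t. r * H t - (HH t - HH (t - r)))"
  define L where "L = (\<lambda>t. Z t + \<mu> * (S t + J t))"
  have k: "k \<alpha> \<ge> 1" using \<alpha> by (simp add: k_def)
  have \<mu>: "\<mu> > 0" using k \<gamma> by (simp add: \<mu>_def)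
  have H': "(H has_vector_derivative v t) (at t within {-r..})" if "-r \<le> t" for t
    unfolding H_def by (rule integral_has_vector_derivative_atLeast [OF cont that])
  have cont_H: "continuous_on {-r..} H"
    using H' by (auto simp: continuous_on_eq_continuous_within intro: has_vector_derivative_continuous)
  have HH': "(HH has_vector_derivative H t) (at t within {-r..})" if "-r \<le> t" for t
    unfolding HH_def by (rule integral_has_vector_derivative_atLeast [OF cont_H that])
  have J_H: "J t = H t - H (t - r)" if "0 \<le> t" for t
    unfolding J H_def by (rule integral_atLeast_diff [OF cont, symmetric]) (use that r in auto)
  have H_diff: "H t - H s = integral {s..t} v" if "-r \<le> s" "s \<le> t" for s t
    unfolding H_def by (rule integral_atLeast_diff [OF cont]) (use that in auto)
  have H_mono: "H s \<le> H t" if "-r \<le> s" "s \<le> t" for s t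
  proof -
    have "integral {s..t} v \<ge> 0"
      by (intro integral_nonneg integrable_continuous_real continuous_on_subset [OF cont])
        (use that v in auto)
    then show ?thesis using H_diff [OF that] by simp
  qed
  have J_nonneg: "0 \<le> J t" if "0 \<le> t" for t
    using that r H_mono [of "t - r" t] by (simp add: J_H)
  have S_bounds: "0 \<le> S t \<and> S t \<le> r * J t" if t: "0 \<le> t" for t
  proof -
    have "HH t - HH (t - r) = integral {t-r..t} H"
      unfolding HH_def by (rule integral_atLeast_diff [OF cont_H]) (use t r in auto)
    moreover have int: "H integrable_on {t-r..t}"
      by (intro integrable_continuous_real continuous_on_subset [OF cont_H]) (use t in auto)
    have "integral {t-r..t} H \<le> integral {t-r..t} (\<lambda>_. H t)"
      by (rule integral_le [OF int]) (use t H_mono in auto)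
    moreover have "integral {t-r..t} (\<lambda>_. H (t-r)) \<le> integral {t-r..t} H"
      by (rule integral_le [OF _ int]) (use t H_mono in auto)
    ultimately show ?thesis
      using r by (simp add: S_def J_H t algebra_simps)
  qed
  define L' where "L' = (\<lambda>t. Z' t + \<mu> * ((r * v t - J t) + (v t - v (t - r))))"
  have L': "(L has_real_derivative L' t) (at t within {0..})" if t: "0 \<le> t" for t
  proof -
    have sub: "{0..} \<subseteq> {-r..}" using r by auto
    have sh: "(\<lambda>t. t - r) ` {0..} \<subseteq> {-r..}" by auto
    have 1: "(H has_real_derivative v t) (at t within {0..})"
      using has_vector_derivative_within_subset [OF H' sub] t r
      by (simp add: has_real_derivative_iff_has_vector_derivative)
    have 2: "((\<lambda>t. H (t - r)) has_real_derivative v (t - r)) (at t within {0..})"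
      unfolding has_real_derivative_iff_has_vector_derivative
      by (rule has_vector_derivative_shift [OF H' sh]) (use t in auto)
    have 3: "(HH has_real_derivative H t) (at t within {0..})"
      using has_vector_derivative_within_subset [OF HH' sub] t r
      by (simp add: has_real_derivative_iff_has_vector_derivative)
    have 4: "((\<lambda>t. HH (t - r)) has_real_derivative H (t - r)) (at t within {0..})"
      unfolding has_real_derivative_iff_has_vector_derivative
      by (rule has_vector_derivative_shift [OF HH' sh]) (use t in auto)
    have "((\<lambda>t. Z t + \<mu> * ((r * H t - (HH t - HH (t - r))) + (H t - H (t - r)))) has_real_derivative L' t) (at t within {0..})"
      unfolding L'_def
      by (auto intro!: derivative_eq_intros 1 2 3 4 Z' t simp: J_H t)
    moreover have "L s = Z s + \<mu> * ((r * H s - (HH s - HH (s - r))) + (H s - H (s - r)))" if "s \<in> {0..}" for s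
      using that by (simp add: L_def S_def J_H)
    ultimately show ?thesis
      using t by (auto intro: has_field_derivative_transform_within [OF _ zero_less_one])
  qed
  have L'_le: "L' t \<le> - \<sigma> * L t" if t: "0 \<le> t" for t
  proof -
    define \<rho> where "\<rho> = r + 1"
    define c where "c = \<alpha> + k \<alpha> * \<rho>"
    have c: "c \<ge> 0" "\<rho> > 0" using \<alpha> k r by (auto simp: c_def \<rho>_def)
    have Jt: "0 \<le> J t" and Zt: "0 \<le> Z t" using J_nonneg Z t by auto
    \<comment> \<open>The derivative of S is r v - J and that of J is v - v (t - r). The delayed
      value has a favourable sign and is dropped, so the two terms together cost (r + 1) v.\<close>
    have "L' t \<le> Z' t + \<mu> * (\<rho> * v t - J t)"
      unfolding L'_def using \<mu> v [of "t - r"] t by (intro add_mono mult_left_mono) (auto simp: \<rho>_def algebra_simps)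
    also have "\<dots> \<le> - \<gamma> * Z t + \<alpha> * \<gamma>\<^sup>2 * (v t + J t) + \<mu> * (\<rho> * v t - J t)"
      using decay [OF t] by simp
    also have "\<dots> = - \<gamma> * Z t - (\<alpha> + 1) * \<gamma>\<^sup>2 * J t + c * \<gamma>\<^sup>2 * v t"
      by (simp add: \<mu>_def c_def k_def algebra_simps)
    also have "\<dots> \<le> - \<gamma> * Z t - (\<alpha> + 1) * \<gamma>\<^sup>2 * J t + c * \<gamma>\<^sup>2 * (2 * Z t + \<beta> * \<gamma> * J t)"
      using v_le [OF t] c by (intro add_mono mult_left_mono) auto
    \<comment> \<open>Regrouped so that the bracketed factors are the left-hand sides of
      \<open>small1\<close> and \<open>small2\<close>.\<close>
    also have "\<dots> = - \<gamma> * Z t - (\<alpha> + 1) * \<gamma>\<^sup>2 * J t + (4 * c * \<gamma>) * (\<gamma> / 2 * Z t) + (2 * c * \<beta> * \<gamma>) * (\<gamma>\<^sup>2 / 2 * J t)"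
      by (simp add: algebra_simps power2_eq_square)
    also have "\<dots> \<le> - \<gamma> * Z t - (\<alpha> + 1) * \<gamma>\<^sup>2 * J t + 1 * (\<gamma> / 2 * Z t) + 1 * (\<gamma>\<^sup>2 / 2 * J t)"
      using small1 small2 Jt Zt \<gamma> by (intro add_mono mult_right_mono) (auto simp: c_def \<rho>_def)
    also have "\<dots> \<le> - (\<gamma> / 2) * Z t - \<gamma>\<^sup>2 / 2 * J t"
    proof -
      have "0 \<le> \<alpha> * (\<gamma>\<^sup>2 * J t)" using \<alpha> Jt by simp
      then show ?thesis by (simp add: algebra_simps)
    qed
    also have "\<gamma>\<^sup>2 / 2 * J t = 1 / (2 * k \<alpha> * \<rho>) * (\<mu> * (\<rho> * J t))"
      using k c by (simp add: \<mu>_def)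
    also have "- (\<gamma> / 2) * Z t - 1 / (2 * k \<alpha> * \<rho>) * (\<mu> * (\<rho> * J t)) \<le> - \<sigma> * Z t - \<sigma> * (\<mu> * (S t + J t))"
    proof -
      have "\<sigma> * Z t \<le> \<gamma> / 2 * Z t"
        using Zt by (intro mult_right_mono) (auto simp: \<sigma>_def)
      moreover have "\<sigma> * (\<mu> * (S t + J t)) \<le> 1 / (2 * k \<alpha> * \<rho>) * (\<mu> * (\<rho> * J t))"
      proof (rule mult_mono)
        show "\<mu> * (S t + J t) \<le> \<mu> * (\<rho> * J t)"
          using S_bounds [OF t] \<mu> by (simp add: \<rho>_def algebra_simps)
        show "0 \<le> \<mu> * (S t + J t)"
          using S_bounds [OF t] \<mu> Jt by simp
      qed (use k c in \<open>auto simp: \<sigma>_def \<rho>_def\<close>)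
      ultimately show ?thesis by simp
    qed
    finally show ?thesis by (simp add: L_def algebra_simps)
  qed
  have "L t \<le> exp (- \<sigma> * (t - 0)) * L 0"
  proof (rule differential_inequality_exp [OF t])
    show "(L has_real_derivative L' s) (at s within {0..t})" if "s \<in> {0..t}" for s
      by (rule DERIV_subset [OF L']) (use that in auto)
    show "L' s \<le> - \<sigma> * L s" if "s \<in> {0..t}" for s
      using L'_le that by simp
  qed
  also have "\<dots> \<le> exp (- \<sigma> * (t - 0)) * (Z 0 + \<mu> * ((r + 1) * J 0))"
    unfolding L_def using S_bounds [of 0] \<mu>
    by (intro mult_left_mono add_left_mono) (simp_all add: distrib_right)
  finally have L: "L t \<le> exp (- \<sigma> * t) * (Z 0 + \<mu> * (r + 1) * J 0)"
    by (simp add: mult.assoc)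
  have "v t \<le> 2 * Z t + \<beta> * \<gamma> * J t" by (rule v_le [OF t])
  \<comment> \<open>The functional controls J only with the weight \<mu>, which puts \<gamma> into a
    denominator of the final constant. This is harmless because only the rate and finiteness for
    fixed \<gamma> matter.\<close>
  also have "\<dots> = 2 * Z t + \<beta> / (k \<alpha> * \<gamma>) * (\<mu> * J t)"
    using k \<gamma> by (simp add: \<mu>_def power2_eq_square)
  also have "\<dots> \<le> 2 * L t + \<beta> / (k \<alpha> * \<gamma>) * L t"
  proof (intro add_mono mult_left_mono)
    have "0 \<le> \<mu> * S t" "0 \<le> \<mu> * J t"
      using S_bounds [OF t] J_nonneg [OF t] \<mu> by simp_all
    then show "Z t \<le> L t" "\<mu> * J t \<le> L t"
      using Z [OF t] by (simp_all add: L_def distrib_left)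
  qed (use \<beta> k \<gamma> in auto)
  also have "\<dots> = (2 + \<beta> / (k \<alpha> * \<gamma>)) * L t"
    by (simp only: distrib_right)
  also have "\<dots> \<le> (2 + \<beta> / (k \<alpha> * \<gamma>)) * (exp (- \<sigma> * t) * (Z 0 + \<mu> * (r + 1) * J 0))"
    using \<beta> k \<gamma> L by (intro mult_left_mono) auto
  finally show ?thesis unfolding \<sigma>_def \<mu>_def .
qed

section \<open>The truncated gain and the delay transformation\<close>

lemma matrix_exp_norm_bound:
  assumes M: "\<And>x. norm (M *v x) \<le> m * norm x" and t: "0 \<le> t"
  shows "norm (matrix_exp (t *\<^sub>R M) *v y) \<le> exp (m * t) * norm y"
proof -
  let ?q = "\<lambda>t. matrix_exp (t *\<^sub>R M) *v y"
  have q': "(?q has_vector_derivative M *v ?q s) (at s within S)" for s S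
    using matrix_exp_comp_vector [OF DERIV_ident, of M y s S] by (simp add: matrix_vector_mul_assoc)
  have "?q t \<bullet> ?q t \<le> exp (2 * m * (t - 0)) * (?q 0 \<bullet> ?q 0)"
  proof (rule differential_inequality_exp [OF t])
    show "((\<lambda>t. ?q t \<bullet> ?q t) has_real_derivative ?q s \<bullet> (M *v ?q s) + (M *v ?q s) \<bullet> ?q s) (at s within {0..t})" for s
      unfolding has_real_derivative_iff_has_vector_derivative
      by (rule bounded_bilinear.has_vector_derivative [OF bounded_bilinear_inner q' q'])
    have "?q s \<bullet> (M *v ?q s) \<le> m * (?q s \<bullet> ?q s)" for s
    proof -
      have "?q s \<bullet> (M *v ?q s) \<le> norm (?q s) * norm (M *v ?q s)"
        by (rule norm_cauchy_schwarz)
      also have "\<dots> \<le> norm (?q s) * (m * norm (?q s))"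
        by (intro mult_left_mono M norm_ge_zero)
      finally show ?thesis
        by (simp add: power2_norm_eq_inner [symmetric] power2_eq_square mult_ac)
    qed
    then show "?q s \<bullet> (M *v ?q s) + (M *v ?q s) \<bullet> ?q s \<le> 2 * m * (?q s \<bullet> ?q s)" for s
      by (simp add: inner_commute)
  qed
  then have "(norm (?q t))\<^sup>2 \<le> (exp (m * t) * norm y)\<^sup>2"
    by (simp add: power2_norm_eq_inner power_mult_distrib exp_double [symmetric] mult.assoc)
  then show ?thesis
    by (rule power2_le_imp_le) simp
qed

text \<open>Along x' = - A x the Riccati identity gives \<gamma> V minus a square, so V grows at
  rate at most \<gamma>. In the forward direction the square would have the wrong sign; the gain
  contains precisely the backward exponential.\<close>

lemma riccati_backward_flow:
  assumes P: "positive_definite P" and ric: "riccati A B \<gamma> P" and t: "0 \<le> t"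
  shows "quadratic_form P (matrix_exp (- t *\<^sub>R A) *v x) \<le> exp (\<gamma> * t) * quadratic_form P x"
proof -
  let ?q = "\<lambda>t. matrix_exp (- t *\<^sub>R A) *v x"
  have q': "(?q has_vector_derivative - (A *v ?q s)) (at s within S)" for s S
  proof -
    have "(?q has_vector_derivative (-1 *\<^sub>R (A ** matrix_exp (- s *\<^sub>R A))) *v x) (at s within S)"
      by (rule matrix_exp_comp_vector) (auto intro!: derivative_eq_intros)
    then show ?thesis
      by (simp add: matrix_vector_mult_minus matrix_vector_mul_assoc)
  qed
  have "quadratic_form P (?q t) \<le> exp (\<gamma> * (t - 0)) * quadratic_form P (?q 0)"
  proof (rule differential_inequality_exp [OF t])
    show "((\<lambda>t. quadratic_form P (?q t)) has_real_derivative
        ?q s \<bullet> (P *v - (A *v ?q s)) + - (A *v ?q s) \<bullet> (P *v ?q s)) (at s within {0..t})" for s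
      unfolding has_real_derivative_iff_has_vector_derivative
      by (intro bounded_bilinear.has_vector_derivative [OF bounded_bilinear_inner]
          bounded_linear.has_vector_derivative [OF matrix_vector_mul_bounded_linear] q')
    have "?q s \<bullet> (P *v - (A *v ?q s)) = - ((P *v ?q s) \<bullet> (A *v ?q s))" for s
      by (simp add: positive_definite_inner_commute [OF P, symmetric])
    then show "?q s \<bullet> (P *v - (A *v ?q s)) + - (A *v ?q s) \<bullet> (P *v ?q s) \<le> \<gamma> * quadratic_form P (?q s)" for s
      using riccati_quadratic_form [OF P ric, of "?q s"] zero_le_power2 [of "norm (transpose B *v (P *v ?q s))"]
      by (simp add: inner_commute)
  qed
  then show ?thesis by simp
qed

text \<open>A Duhamel estimate: the derivative of e^(t (A + D)) e^(- t A) x is e^(t (A + D)) D e^(-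
  t A) x, and the mean value inequality applies. Bounding \<open>D\<close> only along the backward
  orbit of \<open>x\<close>, rather than as an operator, keeps the later bound in terms of
  V(x).\<close>

lemma matrix_exp_perturbation:
  fixes A :: "real^'n^'n"
  assumes M: "\<And>y. norm ((A + D) *v y) \<le> m * norm y" and m: "0 \<le> m" and \<tau>: "0 \<le> \<tau>"
    and D: "\<And>t. 0 \<le> t \<Longrightarrow> t \<le> \<tau> \<Longrightarrow> norm (D *v (matrix_exp (- t *\<^sub>R A) *v x)) \<le> d"
  shows "norm (matrix_exp (\<tau> *\<^sub>R (A + D)) *v (matrix_exp (- \<tau> *\<^sub>R A) *v x) - x) \<le> exp (m * \<tau>) * d * \<tau>"
proof -
  let ?f = "\<lambda>t. matrix_exp (t *\<^sub>R (A + D)) *v (matrix_exp (- t *\<^sub>R A) *v x)"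
  have f': "(?f has_vector_derivative matrix_exp (t *\<^sub>R (A + D)) *v (D *v (matrix_exp (- t *\<^sub>R A) *v x)))
      (at t within {0..\<tau>})" for t
  proof -
    let ?E = "matrix_exp (t *\<^sub>R (A + D))" and ?y = "matrix_exp (- t *\<^sub>R A) *v x"
    have "((\<lambda>t. matrix_exp (- t *\<^sub>R A) *v x) has_vector_derivative
        (-1 *\<^sub>R (A ** matrix_exp (- t *\<^sub>R A))) *v x) (at t within {0..\<tau>})"
      by (rule matrix_exp_comp_vector) (auto intro!: derivative_eq_intros)
    from has_vector_derivative_matrix_vector_mult [OF matrix_exp_has_vector_derivative this]
    show ?thesis
    proof (rule has_vector_derivative_eq_rhs)
      have "((A + D) ** ?E) *v ?y = ?E *v ((A + D) *v ?y)"
        by (simp only: matrix_exp_commute matrix_vector_mul_assoc matrix_mul_assoc)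
      then show "?E *v ((-1 *\<^sub>R (A ** matrix_exp (- t *\<^sub>R A))) *v x) + ((A + D) ** ?E) *v ?y = ?E *v (D *v ?y)"
        by (simp only: scaleR_matrix_vector_assoc [symmetric] matrix_vector_mult_scaleR
            matrix_vector_mul_assoc [symmetric] matrix_vector_mult_add_rdistrib matrix_vector_right_distrib) simp
    qed
  qed
  have "norm (?f \<tau> - ?f 0) \<le> (exp (m * \<tau>) * d) * norm (\<tau> - 0)"
  proof (rule differentiable_bound [OF convex_real_interval(5) f' [unfolded has_vector_derivative_def]])
    have "norm (matrix_exp (t *\<^sub>R (A + D)) *v (D *v (matrix_exp (- t *\<^sub>R A) *v x))) \<le> exp (m * \<tau>) * d"
      if "t \<in> {0..\<tau>}" for t
    proof -
      have "norm (matrix_exp (t *\<^sub>R (A + D)) *v (D *v (matrix_exp (- t *\<^sub>R A) *v x)))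
          \<le> exp (m * t) * norm (D *v (matrix_exp (- t *\<^sub>R A) *v x))"
        using that by (intro matrix_exp_norm_bound M) simp
      also have "\<dots> \<le> exp (m * \<tau>) * d"
        using that m D [of t] by (intro mult_mono) (auto simp: mult_left_mono)
      finally show ?thesis .
    qed
    then show "onorm (\<lambda>h. h *\<^sub>R (matrix_exp (t *\<^sub>R (A + D)) *v (D *v (matrix_exp (- t *\<^sub>R A) *v x))))
        \<le> exp (m * \<tau>) * d" if "t \<in> {0..\<tau>}" for t
      using that by (intro onorm_le) (simp add: mult.commute mult_left_mono)
  qed (use \<tau> in auto)
  then show ?thesis using \<tau> by simp
qed

section \<open>Artstein's delay integrals\<close>

lemma power2_integral_le:
  fixes f :: "real \<Rightarrow> real"
  assumes "a \<le> b" and cont: "continuous_on {a..b} f"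
  shows "(integral {a..b} f)\<^sup>2 \<le> (b - a) * integral {a..b} (\<lambda>s. (f s)\<^sup>2)"
proof (cases "a < b")
  case True
  \<comment> \<open>The mean value of \<open>f\<close>: nonnegativity of the integrated squared
    deviation from it is the Cauchy-Schwarz inequality.\<close>
  define m where "m = integral {a..b} f / (b - a)"
  have "0 \<le> integral {a..b} (\<lambda>s. (f s - m)\<^sup>2)"
    by (intro integral_nonneg integrable_continuous_real continuous_intros cont) auto
  also have "(\<lambda>s. (f s - m)\<^sup>2) = (\<lambda>s. (f s)\<^sup>2 - 2 * m * f s + m\<^sup>2)"
    by (simp add: power2_diff fun_eq_iff)
  also have "integral {a..b} (\<lambda>s. (f s)\<^sup>2 - 2 * m * f s + m\<^sup>2)
      = integral {a..b} (\<lambda>s. (f s)\<^sup>2) - 2 * m * integral {a..b} f + m\<^sup>2 * (b - a)"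
  proof (rule integral_unique)
    have "((\<lambda>s. m\<^sup>2) has_integral m\<^sup>2 * (b - a)) {a..b}"
      using has_integral_const_real [of "m\<^sup>2" a b] True by (simp add: mult.commute)
    then show "((\<lambda>s. (f s)\<^sup>2 - 2 * m * f s + m\<^sup>2) has_integral
        integral {a..b} (\<lambda>s. (f s)\<^sup>2) - 2 * m * integral {a..b} f + m\<^sup>2 * (b - a)) {a..b}"
      by (intro has_integral_add has_integral_diff has_integral_mult_right integrable_integral
          integrable_continuous_real continuous_intros cont)
  qed
  also have "\<dots> = integral {a..b} (\<lambda>s. (f s)\<^sup>2) - (integral {a..b} f)\<^sup>2 / (b - a)"
    using True by (simp add: m_def power2_eq_square)
  finally show ?thesis
    using True by (simp add: field_simps)
qed (use assms(1) in auto)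

text \<open>The integral of \<open>matrix_exp ((t - h - s) *\<^sub>R A) *v (B *v u s)\<close> over \<open>{t-h..t}\<close>, written with two
  integrals from the fixed base point \<open>-r\<close> so that it can be differentiated in \<open>t\<close>.\<close>

definition delay_integral :: "real^'n^'n \<Rightarrow> real^'m^'n \<Rightarrow> real \<Rightarrow> real \<Rightarrow> (real \<Rightarrow> real^'m) \<Rightarrow> real \<Rightarrow> real^'n" where
  "delay_integral A B r h u t = matrix_exp ((t - h) *\<^sub>R A) *v
    (integral {-r..t} (\<lambda>s. matrix_exp (- s *\<^sub>R A) *v (B *v u s))
      - integral {-r..t-h} (\<lambda>s. matrix_exp (- s *\<^sub>R A) *v (B *v u s)))"

text \<open>The outer exponential contributes \<open>A\<close> times the integral, the upper limit
  the undelayed input through e^(- h A) B, and the lower limit minus the delayed input. Added to x',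
  these replace each delayed input by its share of the undelayed one.\<close>

lemma delay_integral_has_vector_derivative:
  assumes u: "continuous_on {-r..} u" and h: "0 \<le> h" "h \<le> r" and t: "0 \<le> t"
  shows "(delay_integral A B r h u has_vector_derivative
    A *v delay_integral A B r h u t + matrix_exp (- h *\<^sub>R A) *v (B *v u t) - B *v u (t - h)) (at t within {0..})"
proof -
  let ?g = "\<lambda>s. matrix_exp (- s *\<^sub>R A) *v (B *v u s)"
  define G where "G = (\<lambda>t. integral {-r..t} ?g)"
  have cont: "continuous_on {-r..} ?g"
    by (intro continuous_intros continuous_on_matrix_exp u)
  have G': "(G has_vector_derivative ?g t) (at t within {-r..})" if "-r \<le> t" for t
    unfolding G_def by (rule integral_has_vector_derivative_atLeast [OF cont that])
  have 1: "(G has_vector_derivative ?g t) (at t within {0..})"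
    by (rule has_vector_derivative_within_subset [OF G']) (use t h in auto)
  have 2: "((\<lambda>t. G (t - h)) has_vector_derivative ?g (t - h)) (at t within {0..})"
    by (rule has_vector_derivative_shift [OF G']) (use t h in auto)
  have 3: "((\<lambda>t. matrix_exp ((t - h) *\<^sub>R A)) has_vector_derivative 1 *\<^sub>R (A ** matrix_exp ((t - h) *\<^sub>R A))) (at t within {0..})"
    by (rule matrix_exp_comp_has_vector_derivative) (auto intro!: derivative_eq_intros)
  have "matrix_exp ((t - h) *\<^sub>R A) ** matrix_exp (- t *\<^sub>R A) = matrix_exp (- h *\<^sub>R A)"
    "matrix_exp ((t - h) *\<^sub>R A) ** matrix_exp (- (t - h) *\<^sub>R A) = mat 1"
    by (simp_all only: matrix_exp_add [symmetric]) simp_all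
  then have cancel: "matrix_exp ((t - h) *\<^sub>R A) *v ?g t = matrix_exp (- h *\<^sub>R A) *v (B *v u t)"
    "matrix_exp ((t - h) *\<^sub>R A) *v ?g (t - h) = B *v u (t - h)"
    by (simp_all only: matrix_vector_mul_assoc matrix_mul_assoc matrix_mul_lid)
  have eq: "delay_integral A B r h u = (\<lambda>t. matrix_exp ((t - h) *\<^sub>R A) *v (G t - G (t - h)))"
    by (simp add: fun_eq_iff delay_integral_def G_def)
  from has_vector_derivative_matrix_vector_mult [OF 3 has_vector_derivative_diff [OF 1 2]]
  show ?thesis
    unfolding eq
  proof (rule has_vector_derivative_eq_rhs)
    show "matrix_exp ((t - h) *\<^sub>R A) *v (?g t - ?g (t - h)) + (1 *\<^sub>R (A ** matrix_exp ((t - h) *\<^sub>R A))) *v (G t - G (t - h))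
      = A *v (matrix_exp ((t - h) *\<^sub>R A) *v (G t - G (t - h))) + matrix_exp (- h *\<^sub>R A) *v (B *v u t) - B *v u (t - h)"
      unfolding matrix_vector_mult_diff_distrib [of "matrix_exp ((t - h) *\<^sub>R A)" "?g t"] cancel
      by (simp add: matrix_vector_mul_assoc)
  qed
qed

text \<open>On a window of length \<open>h\<close> the kernel is bounded by exp (a h), and
  Cauchy-Schwarz contributes one more factor \<open>h\<close>. The constant is independent of
  \<open>u\<close>, hence of the feedback and of \<gamma>.\<close>

lemma delay_integral_bound:
  fixes A :: "real^'n^'n" and B :: "real^'m^'n"
  assumes h: "0 \<le> h" "h \<le> r"
  obtains C where "0 \<le> C"
    "\<And>u t. continuous_on {-r..} u \<Longrightarrow> 0 \<le> t \<Longrightarrow>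
      (norm (delay_integral A B r h u t))\<^sup>2 \<le> C * integral {t-r..t} (\<lambda>s. (norm (u s))\<^sup>2)"
proof -
  obtain a where a: "a > 0" "\<And>x. norm (- A *v x) \<le> a * norm x"
    using linear_bounded_pos [OF matrix_vector_mul_linear [of "- A"]] by (auto simp: mult.commute)
  obtain b where b: "b > 0" "\<And>x. norm (B *v x) \<le> b * norm x"
    using linear_bounded_pos [OF matrix_vector_mul_linear [of B]] by (auto simp: mult.commute)
  define c where "c = exp (a * h) * b"
  have c: "0 \<le> c" using b by (simp add: c_def)
  show ?thesis
  proof (rule that)
    show "0 \<le> c\<^sup>2 * h" using h by simp
    fix u :: "real \<Rightarrow> real^'m" and t :: real
    assume u: "continuous_on {-r..} u" and t: "0 \<le> t"
    let ?g = "\<lambda>s. matrix_exp (- s *\<^sub>R A) *v (B *v u s)"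
    have cont: "continuous_on {-r..} ?g"
      by (intro continuous_intros continuous_on_matrix_exp u)
    have u': "continuous_on {t-h..t} u" and u'': "continuous_on {t-r..t} u"
      using t h by (auto intro: continuous_on_subset [OF u])
    have g': "?g integrable_on {t-h..t}"
      using t h by (intro integrable_continuous_real continuous_on_subset [OF cont]) auto
    have "delay_integral A B r h u t = matrix_exp ((t - h) *\<^sub>R A) *v integral {t-h..t} ?g"
      unfolding delay_integral_def
      by (subst integral_atLeast_diff [OF cont]) (use t h in auto)
    also have "\<dots> = integral {t-h..t} (\<lambda>s. matrix_exp ((t - h) *\<^sub>R A) *v ?g s)"
      using integral_linear [OF g' matrix_vector_mul_bounded_linear [of "matrix_exp ((t - h) *\<^sub>R A)"]]
      by (simp add: o_def)
    also have "norm \<dots> \<le> integral {t-h..t} (\<lambda>s. c * norm (u s))"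
    proof (rule integral_norm_bound_integral)
      show "(\<lambda>s. matrix_exp ((t - h) *\<^sub>R A) *v ?g s) integrable_on {t-h..t}"
        by (intro integrable_continuous_real continuous_intros continuous_on_matrix_exp u')
      show "(\<lambda>s. c * norm (u s)) integrable_on {t-h..t}"
        by (intro integrable_continuous_real continuous_intros u')
      fix s assume s: "s \<in> {t-h..t}"
      \<comment> \<open>The exponent t - h - s is nonpositive on the window; it is rewritten as a
        nonnegative multiple of - A to fit \<open>matrix_exp_norm_bound\<close>.\<close>
      have "matrix_exp ((t - h) *\<^sub>R A) *v ?g s = matrix_exp ((s - (t - h)) *\<^sub>R (- A)) *v (B *v u s)"
      proof -
        have "(s - (t - h)) *\<^sub>R (- A) = (t - h + - s) *\<^sub>R A"
          by (simp add: algebra_simps)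
        then show ?thesis
          by (simp only: matrix_exp_add matrix_vector_mul_assoc matrix_mul_assoc)
      qed
      also have "norm \<dots> \<le> exp (a * (s - (t - h))) * norm (B *v u s)"
        using s by (intro matrix_exp_norm_bound a) auto
      also have "\<dots> \<le> exp (a * h) * (b * norm (u s))"
        using s a b by (intro mult_mono) auto
      finally show "norm (matrix_exp ((t - h) *\<^sub>R A) *v ?g s) \<le> c * norm (u s)"
        by (simp add: c_def)
    qed
    also have "\<dots> = c * integral {t-h..t} (\<lambda>s. norm (u s))"
      by simp
    finally have "(norm (delay_integral A B r h u t))\<^sup>2 \<le> (c * integral {t-h..t} (\<lambda>s. norm (u s)))\<^sup>2"
      by (rule power_mono) simp
    also have "\<dots> \<le> c\<^sup>2 * (h * integral {t-h..t} (\<lambda>s. (norm (u s))\<^sup>2))"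
      using power2_integral_le [of "t - h" t "\<lambda>s. norm (u s)"] h u'
      by (simp add: power_mult_distrib mult_left_mono continuous_intros)
    \<comment> \<open>Enlarging the window from \<open>h\<close> to \<open>r\<close> lets integrals
      with different delays share one bound.\<close>
    also have "\<dots> \<le> c\<^sup>2 * (h * integral {t-r..t} (\<lambda>s. (norm (u s))\<^sup>2))"
      using h by (intro mult_left_mono integral_subset_le integrable_continuous_real continuous_intros u' u'') auto
    finally show "(norm (delay_integral A B r h u t))\<^sup>2 \<le> c\<^sup>2 * h * integral {t-r..t} (\<lambda>s. (norm (u s))\<^sup>2)"
      by (simp add: mult.assoc)
  qed
qed

section \<open>Error of the truncated gain\<close>

lemma power2_norm_add_le: "(norm (a + b))\<^sup>2 \<le> 2 * (norm a)\<^sup>2 + 2 * (norm b)\<^sup>2"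
  for a b :: "'a::real_inner"
  using zero_le_power2 [of "norm (a - b)"]
  by (simp add: power2_norm_eq_inner inner_add_left inner_add_right inner_diff_left inner_diff_right)

lemma matrix_vector_norm_bound:
  fixes M :: "real^'n^'m"
  obtains a where "0 < a" "\<And>x. norm (M *v x) \<le> a * norm x"
  using linear_bounded_pos [OF matrix_vector_mul_linear [of M]] by (auto simp: mult.commute)

text \<open>The difference is F w with w the displacement of \<open>x\<close> by the product of
  exponentials. The outer \<open>F\<close> gives |F w|^2 \<le> \<gamma> n p |w|^2; the perturbation
  bound makes |w|^2 a multiple of the squared feedback along the backward orbit, which brings the
  second \<gamma>. The constant is uniform in \<gamma> since \<open>p\<close> is.\<close>

lemma truncated_gain_estimate:
  fixes A :: "real^'n^'n" and B :: "real^'m^'n"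
  assumes ctrb: "controllable A B" and tr: "trace A = 0" and \<tau>: "0 \<le> \<tau>"
  obtains \<kappa> where "0 \<le> \<kappa>"
    "\<And>\<gamma> P F x. 0 < \<gamma> \<Longrightarrow> \<gamma> \<le> 1 \<Longrightarrow> positive_definite P \<Longrightarrow> riccati A B \<gamma> P \<Longrightarrow>
      F = - (transpose B ** P) \<Longrightarrow>
      (norm ((F ** matrix_exp (\<tau> *\<^sub>R (A + B ** F)) ** matrix_exp (- (\<tau> *\<^sub>R A))) *v x - F *v x))\<^sup>2
        \<le> \<kappa> * \<gamma>\<^sup>2 * quadratic_form P x"
proof -
  obtain p where p: "p > 0" and P_bound: "\<And>\<gamma> P v. 0 < \<gamma> \<Longrightarrow> \<gamma> \<le> 1 \<Longrightarrow> positive_definite P \<Longrightarrow>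
      riccati A B \<gamma> P \<Longrightarrow> norm (P *v v) \<le> p * norm v"
    using riccati_bound [OF ctrb] by metis
  obtain a where a: "0 < a" "\<And>x. norm (A *v x) \<le> a * norm x"
    using matrix_vector_norm_bound by metis
  obtain b where b: "0 < b" "\<And>x. norm (B *v x) \<le> b * norm x"
    using matrix_vector_norm_bound by metis
  obtain b' where b': "0 < b'" "\<And>x. norm (transpose B *v x) \<le> b' * norm x"
    using matrix_vector_norm_bound by metis
  \<comment> \<open>A bound for the operator \<open>A + B ** F\<close> that holds for all \<gamma>
    \<le> 1 at once, as \<open>b' * p\<close> bounds \<open>F\<close>.\<close>
  define m where "m = a + b * (b' * p)"
  define n where "n = real CARD('n)"
  define c where "c = exp (m * \<tau>) * b * \<tau>"
  have n: "0 < n" by (simp add: n_def)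
  show ?thesis
  proof (rule that)
    show "0 \<le> n * p * (c\<^sup>2 * (n * exp \<tau>))"
      using n p by simp
    fix \<gamma> :: real and P F x
    assume \<gamma>: "0 < \<gamma>" "\<gamma> \<le> 1" and P: "positive_definite P" and ric: "riccati A B \<gamma> P"
      and F: "F = - (transpose B ** P)"
    let ?V = "quadratic_form P"
    have F_norm: "norm (F *v y) = norm (transpose B *v (P *v y))" for y
      by (simp add: F matrix_vector_mult_minus matrix_vector_mul_assoc)
    have F_bound: "(norm (F *v y))\<^sup>2 \<le> \<gamma> * n * ?V y" for y
      unfolding F_norm n_def by (rule riccati_feedback_bound [OF P ric tr])
    have V_bound: "?V y \<le> p * (norm y)\<^sup>2" for y
      by (intro quadratic_form_le P_bound [OF \<gamma> P ric])
    have V_nonneg: "0 \<le> ?V y" for y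
      by (rule positive_definite_nonneg [OF P])
    define d where "d = b * sqrt (\<gamma> * n * (exp \<tau> * ?V x))"
    have close: "norm (matrix_exp (\<tau> *\<^sub>R (A + B ** F)) *v (matrix_exp (- \<tau> *\<^sub>R A) *v x) - x)
        \<le> exp (m * \<tau>) * d * \<tau>"
    proof (rule matrix_exp_perturbation)
      show "0 \<le> m" using a b b' p by (simp add: m_def)
      show "norm ((A + B ** F) *v y) \<le> m * norm y" for y
      proof -
        have "norm ((A + B ** F) *v y) \<le> norm (A *v y) + norm (B *v (F *v y))"
          by (simp add: matrix_vector_mult_add_rdistrib matrix_vector_mul_assoc norm_triangle_ineq)
        also have "\<dots> \<le> a * norm y + b * (b' * (p * norm y))"
        proof (intro add_mono a)
          have "norm (B *v (F *v y)) \<le> b * norm (transpose B *v (P *v y))"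
            using b(2) F_norm by metis
          also have "\<dots> \<le> b * (b' * norm (P *v y))"
            using b by (intro mult_left_mono b') simp
          also have "\<dots> \<le> b * (b' * (p * norm y))"
            using b b' by (intro mult_left_mono P_bound [OF \<gamma> P ric]) simp_all
          finally show "norm (B *v (F *v y)) \<le> b * (b' * (p * norm y))" .
        qed
        finally show ?thesis by (simp add: m_def algebra_simps)
      qed
      show "norm ((B ** F) *v (matrix_exp (- t *\<^sub>R A) *v x)) \<le> d" if t: "0 \<le> t" "t \<le> \<tau>" for t
      proof -
        let ?y = "matrix_exp (- t *\<^sub>R A) *v x"
        have "(norm (F *v ?y))\<^sup>2 \<le> \<gamma> * n * ?V ?y"
          by (rule F_bound)
        also have "\<dots> \<le> \<gamma> * n * (exp (\<gamma> * t) * ?V x)"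
          using \<gamma> n by (intro mult_left_mono riccati_backward_flow [OF P ric t(1)]) simp
        also have "\<dots> \<le> \<gamma> * n * (exp \<tau> * ?V x)"
        proof (intro mult_left_mono mult_right_mono V_nonneg)
          have "\<gamma> * t \<le> 1 * \<tau>" using \<gamma> t by (intro mult_mono) simp_all
          then show "exp (\<gamma> * t) \<le> exp \<tau>" by simp
        qed (use \<gamma> n in simp)
        finally have "norm (F *v ?y) \<le> sqrt (\<gamma> * n * (exp \<tau> * ?V x))"
          by (rule real_le_rsqrt)
        then have "b * norm (F *v ?y) \<le> d"
          using b by (simp add: d_def)
        then show ?thesis
          using b(2) [of "F *v ?y"] by (simp add: matrix_vector_mul_assoc matrix_mul_assoc)
      qed
    qed (rule \<tau>)
    let ?w = "matrix_exp (\<tau> *\<^sub>R (A + B ** F)) *v (matrix_exp (- \<tau> *\<^sub>R A) *v x) - x"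
    have "(F ** matrix_exp (\<tau> *\<^sub>R (A + B ** F)) ** matrix_exp (- (\<tau> *\<^sub>R A))) *v x - F *v x = F *v ?w"
      by (simp add: matrix_vector_mult_diff_distrib matrix_vector_mul_assoc matrix_mul_assoc)
    then have "(norm ((F ** matrix_exp (\<tau> *\<^sub>R (A + B ** F)) ** matrix_exp (- (\<tau> *\<^sub>R A))) *v x - F *v x))\<^sup>2
        \<le> \<gamma> * n * ?V ?w"
      by (simp only: F_bound)
    also have "\<dots> \<le> \<gamma> * n * (p * (norm ?w)\<^sup>2)"
      using \<gamma> n by (intro mult_left_mono V_bound) simp
    also have "\<dots> \<le> \<gamma> * n * (p * (exp (m * \<tau>) * d * \<tau>)\<^sup>2)"
      using \<gamma> n p by (intro mult_left_mono power_mono close) simp_all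
    also have "(exp (m * \<tau>) * d * \<tau>)\<^sup>2 = c\<^sup>2 * (\<gamma> * n * (exp \<tau> * ?V x))"
      using \<gamma> n V_nonneg [of x] by (simp add: c_def d_def power_mult_distrib)
    also have "\<gamma> * n * (p * (c\<^sup>2 * (\<gamma> * n * (exp \<tau> * ?V x)))) = n * p * (c\<^sup>2 * (n * exp \<tau>)) * \<gamma>\<^sup>2 * ?V x"
      by (simp add: power2_eq_square)
    finally show "(norm ((F ** matrix_exp (\<tau> *\<^sub>R (A + B ** F)) ** matrix_exp (- (\<tau> *\<^sub>R A))) *v x - F *v x))\<^sup>2
        \<le> n * p * (c\<^sup>2 * (n * exp \<tau>)) * \<gamma>\<^sup>2 * ?V x" .
  qed
qed

section \<open>From an exponential estimate to asymptotic stability\<close>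

lemma asymptotically_stableI:
  assumes M: "0 \<le> M" and \<sigma>: "0 < \<sigma>"
    and cont: "\<And>x. x \<in> S \<Longrightarrow> continuous_on {-r..0} x"
    and decay: "\<And>x \<eta> t. x \<in> S \<Longrightarrow> (\<And>s. s \<in> {-r..0} \<Longrightarrow> norm (x s) \<le> \<eta>) \<Longrightarrow> 0 \<le> \<eta> \<Longrightarrow> 0 \<le> t \<Longrightarrow>
      (norm (x t))\<^sup>2 \<le> M * exp (- \<sigma> * t) * \<eta>\<^sup>2"
  shows "asymptotically_stable r S"
  unfolding asymptotically_stable_def
proof (intro conjI allI impI ballI)
  fix \<epsilon> :: real
  assume \<epsilon>: "\<epsilon> > 0"
  \<comment> \<open>Using M + 1 instead of M makes the denominator positive and the final inequality
    strict.\<close>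
  define \<delta> where "\<delta> = \<epsilon> / sqrt (M + 1)"
  have \<delta>: "\<delta> > 0" "\<delta>\<^sup>2 * (M + 1) = \<epsilon>\<^sup>2"
    using \<epsilon> M by (simp_all add: \<delta>_def power_divide)
  show "\<exists>\<delta>>0. \<forall>x\<in>S. (\<forall>s\<in>{-r..0}. norm (x s) < \<delta>) \<longrightarrow> (\<forall>t\<ge>0. norm (x t) < \<epsilon>)"
  proof (intro exI conjI ballI impI allI)
    show "0 < \<delta>" by (rule \<delta>)
    fix x and t :: real
    assume x: "x \<in> S" and small: "\<forall>s\<in>{-r..0}. norm (x s) < \<delta>" and t: "0 \<le> t"
    have "(norm (x t))\<^sup>2 \<le> M * exp (- \<sigma> * t) * \<delta>\<^sup>2"
      using small \<delta> by (intro decay x t) (auto intro: less_imp_le)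
    also have "\<dots> \<le> M * 1 * \<delta>\<^sup>2"
      using M \<sigma> t by (intro mult_right_mono mult_left_mono) auto
    also have "\<dots> < \<epsilon>\<^sup>2"
      unfolding \<delta>(2) [symmetric] using \<delta>(1) by (simp add: algebra_simps)
    finally show "norm (x t) < \<epsilon>"
      by (rule power2_less_imp_less) (use \<epsilon> in simp)
  qed
next
  fix x
  assume x: "x \<in> S"
  have "bounded (x ` {-r..0})"
    by (intro compact_imp_bounded compact_continuous_image cont [OF x] compact_Icc)
  then obtain \<eta> where \<eta>: "0 < \<eta>" "\<And>s. s \<in> {-r..0} \<Longrightarrow> norm (x s) \<le> \<eta>"
    by (auto simp: bounded_pos)
  have "((\<lambda>t. exp (- \<sigma> * t)) \<longlongrightarrow> 0) at_top"
    using \<sigma> by real_asymp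
  then have lim: "((\<lambda>t. M * exp (- \<sigma> * t) * \<eta>\<^sup>2) \<longlongrightarrow> 0) at_top"
    by (intro tendsto_mult_left_zero tendsto_mult_right_zero)
  have "((\<lambda>t. (norm (x t))\<^sup>2) \<longlongrightarrow> 0) at_top"
  proof (rule tendsto_sandwich [OF _ _ tendsto_const lim])
    show "\<forall>\<^sub>F t in at_top. (norm (x t))\<^sup>2 \<le> M * exp (- \<sigma> * t) * \<eta>\<^sup>2"
      using eventually_ge_at_top [of 0]
      by (rule eventually_mono) (use decay [OF x \<eta>(2)] \<eta>(1) in simp)
  qed simp
  from tendsto_real_sqrt [OF this] show "(x \<longlongrightarrow> 0) at_top"
    by (simp add: tendsto_norm_zero_iff)
qed

section \<open>Stability of the closed loop\<close>

lemma power2_norm_add3_le: "(norm (a + b + c))\<^sup>2 \<le> 3 * (norm a)\<^sup>2 + 3 * (norm b)\<^sup>2 + 3 * (norm c)\<^sup>2"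
proof -
  have "norm (a + b + c) \<le> norm a + norm b + norm c"
    by norm
  then have "(norm (a + b + c))\<^sup>2 \<le> (norm a + norm b + norm c)\<^sup>2"
    by (rule power_mono) simp
  also have "\<dots> \<le> 3 * (norm a)\<^sup>2 + 3 * (norm b)\<^sup>2 + 3 * (norm c)\<^sup>2"
    using zero_le_power2 [of "norm a - norm b"] zero_le_power2 [of "norm b - norm c"]
      zero_le_power2 [of "norm a - norm c"]
    by (simp add: power2_eq_square algebra_simps)
  finally show ?thesis .
qed

lemma three_delay_integrals_bound:
  fixes A :: "real^'n^'n" and B1 B2 B3 :: "real^'m^'n"
  assumes delays: "0 \<le> \<tau>1" "\<tau>1 \<le> \<tau>2" "\<tau>2 \<le> \<tau>3"
  obtains C where "0 \<le> C"
    "\<And>u t. continuous_on {-\<tau>3..} u \<Longrightarrow> 0 \<le> t \<Longrightarrow>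
      (norm (delay_integral A B1 \<tau>3 \<tau>1 u t + delay_integral A B2 \<tau>3 \<tau>2 u t + delay_integral A B3 \<tau>3 \<tau>3 u t))\<^sup>2
        \<le> C * integral {t-\<tau>3..t} (\<lambda>s. (norm (u s))\<^sup>2)"
proof -
  obtain C1 where C1: "0 \<le> C1" "\<And>u t. continuous_on {-\<tau>3..} u \<Longrightarrow> 0 \<le> t \<Longrightarrow>
      (norm (delay_integral A B1 \<tau>3 \<tau>1 u t))\<^sup>2 \<le> C1 * integral {t-\<tau>3..t} (\<lambda>s. (norm (u s))\<^sup>2)"
    by (rule delay_integral_bound [where A = A and B = B1 and h = \<tau>1 and r = \<tau>3]) (use delays that in auto)
  obtain C2 where C2: "0 \<le> C2" "\<And>u t. continuous_on {-\<tau>3..} u \<Longrightarrow> 0 \<le> t \<Longrightarrow>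
      (norm (delay_integral A B2 \<tau>3 \<tau>2 u t))\<^sup>2 \<le> C2 * integral {t-\<tau>3..t} (\<lambda>s. (norm (u s))\<^sup>2)"
    by (rule delay_integral_bound [where A = A and B = B2 and h = \<tau>2 and r = \<tau>3]) (use delays that in auto)
  obtain C3 where C3: "0 \<le> C3" "\<And>u t. continuous_on {-\<tau>3..} u \<Longrightarrow> 0 \<le> t \<Longrightarrow>
      (norm (delay_integral A B3 \<tau>3 \<tau>3 u t))\<^sup>2 \<le> C3 * integral {t-\<tau>3..t} (\<lambda>s. (norm (u s))\<^sup>2)"
    by (rule delay_integral_bound [where A = A and B = B3 and h = \<tau>3 and r = \<tau>3]) (use delays that in auto)
  show ?thesis
  proof (rule that)
    show "0 \<le> 3 * (C1 + C2 + C3)"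
      using C1(1) C2(1) C3(1) by simp
    fix u :: "real \<Rightarrow> real^'m" and t :: real
    assume u: "continuous_on {-\<tau>3..} u" "0 \<le> t"
    show "(norm (delay_integral A B1 \<tau>3 \<tau>1 u t + delay_integral A B2 \<tau>3 \<tau>2 u t + delay_integral A B3 \<tau>3 \<tau>3 u t))\<^sup>2
      \<le> 3 * (C1 + C2 + C3) * integral {t-\<tau>3..t} (\<lambda>s. (norm (u s))\<^sup>2)"
      using power2_norm_add3_le [of "delay_integral A B1 \<tau>3 \<tau>1 u t" "delay_integral A B2 \<tau>3 \<tau>2 u t"
          "delay_integral A B3 \<tau>3 \<tau>3 u t"] C1(2) [OF u] C2(2) [OF u] C3(2) [OF u]
      by (simp add: algebra_simps)
  qed
qed

text \<open>Instantiates \<open>delay_Lyapunov_decay\<close> with z = x + D, D being the sum of the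
  delay integrals. Splitting K into F and K - F, with \<gamma>^2 \<le> \<gamma>, gives |K y|^2 \<le>
  q \<gamma> V(y), so V(D) is at most p C q \<gamma> J. Doubling this yields \<beta>; in \<alpha>
  the part 2 \<kappa> comes from (K - F) x and the rest from F D.\<close>

lemma closed_loop_decay:
  fixes A P :: "real^'n^'n" and B1 B2 B3 B :: "real^'m^'n" and \<alpha> \<beta> \<gamma> \<tau>1 \<tau>2 \<tau>3 C \<kappa> p :: real and K F :: "real^'n^'m"
  defines "n \<equiv> real CARD('n)"
  defines "V \<equiv> quadratic_form P"
  defines "q \<equiv> 2 * (n + \<kappa>)"
  defines "\<alpha> \<equiv> 2 * \<kappa> + 2 * n * p * C * q" and "\<beta> \<equiv> 2 * p * C * q"
  assumes delays: "0 \<le> \<tau>1" "\<tau>1 \<le> \<tau>2" "\<tau>2 \<le> \<tau>3"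
    and B: "B = matrix_exp (- (\<tau>1 *\<^sub>R A)) ** B1 + matrix_exp (- (\<tau>2 *\<^sub>R A)) ** B2
                + matrix_exp (- (\<tau>3 *\<^sub>R A)) ** B3"
    and tr: "trace A = 0"
    and P: "positive_definite P" and ric: "riccati A B \<gamma> P" and F: "F = - (transpose B ** P)"
    and \<gamma>: "0 < \<gamma>" "\<gamma> \<le> 1"
    and p: "0 \<le> p" "\<And>v. norm (P *v v) \<le> p * norm v"
    and \<kappa>: "0 \<le> \<kappa>" "\<And>y. (norm (K *v y - F *v y))\<^sup>2 \<le> \<kappa> * \<gamma>\<^sup>2 * V y"
    and C: "0 \<le> C" "\<And>u t. continuous_on {-\<tau>3..} u \<Longrightarrow> 0 \<le> t \<Longrightarrow>
      (norm (delay_integral A B1 \<tau>3 \<tau>1 u t + delay_integral A B2 \<tau>3 \<tau>2 u t + delay_integral A B3 \<tau>3 \<tau>3 u t))\<^sup>2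
        \<le> C * integral {t-\<tau>3..t} (\<lambda>s. (norm (u s))\<^sup>2)"
    and small1: "4 * (\<alpha> + (2 * \<alpha> + 1) * (\<tau>3 + 1)) * \<gamma> \<le> 1"
    and small2: "2 * (\<alpha> + (2 * \<alpha> + 1) * (\<tau>3 + 1)) * \<beta> * \<gamma> \<le> 1"
    and x: "x \<in> closed_loop_solutions A B1 B2 B3 \<tau>1 \<tau>2 \<tau>3 K"
    and init: "\<And>s. s \<in> {-\<tau>3..0} \<Longrightarrow> norm (x s) \<le> \<eta>"
    and t: "0 \<le> t"
  shows "V (x t) \<le> (2 + \<beta> / ((2 * \<alpha> + 1) * \<gamma>))
    * (exp (- min (\<gamma> / 2) (1 / (2 * (2 * \<alpha> + 1) * (\<tau>3 + 1))) * t)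
      * (2 * p * \<eta>\<^sup>2 + (\<beta> * \<gamma> + (2 * \<alpha> + 1) * \<gamma>\<^sup>2 * (\<tau>3 + 1)) * (\<tau>3 * (p * \<eta>\<^sup>2))))"
proof -
  have n: "0 \<le> n" by (simp add: n_def)
  have q: "0 \<le> q" using n \<kappa>(1) by (simp add: q_def)
  have \<alpha>: "0 \<le> \<alpha>" and \<beta>: "0 \<le> \<beta>"
    using n q p(1) C(1) \<kappa>(1) by (simp_all add: \<alpha>_def \<beta>_def)
  have \<tau>3: "0 \<le> \<tau>3" using delays by simp
  have V_nonneg: "0 \<le> V y" for y
    unfolding V_def by (rule positive_definite_nonneg [OF P])
  have V_bound: "V y \<le> p * (norm y)\<^sup>2" for y
    unfolding V_def by (intro quadratic_form_le p)
  have F_eq: "F *v y = - (transpose B *v (P *v y))" for y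
    by (simp add: F matrix_vector_mult_minus matrix_vector_mul_assoc)
  have F_bound: "(norm (F *v y))\<^sup>2 \<le> \<gamma> * n * V y" for y
    using riccati_feedback_bound [OF P ric tr] by (simp add: F_eq n_def V_def)
  have K_bound: "(norm (K *v y))\<^sup>2 \<le> q * \<gamma> * V y" for y
  proof -
    have "(norm (K *v y))\<^sup>2 \<le> 2 * (norm (F *v y))\<^sup>2 + 2 * (norm (K *v y - F *v y))\<^sup>2"
      using power2_norm_add_le [of "F *v y" "K *v y - F *v y"] by simp
    also have "\<dots> \<le> 2 * (\<gamma> * n * V y) + 2 * (\<kappa> * \<gamma>\<^sup>2 * V y)"
      by (intro add_mono mult_left_mono F_bound \<kappa>(2)) simp_all
    also have "\<dots> \<le> 2 * (\<gamma> * n * V y) + 2 * (\<kappa> * \<gamma> * V y)"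
      using \<gamma> \<kappa>(1) V_nonneg [of y]
      by (intro add_left_mono mult_left_mono mult_right_mono) (simp_all add: power2_eq_square mult_left_le)
    finally show ?thesis by (simp add: q_def algebra_simps)
  qed
  obtain u where cont: "continuous_on {-\<tau>3..} x" and u: "\<And>t. -\<tau>3 \<le> t \<Longrightarrow> u t = K *v x t"
    and x': "\<And>t. 0 \<le> t \<Longrightarrow> (x has_vector_derivative
        (A *v x t + B1 *v u (t - \<tau>1) + B2 *v u (t - \<tau>2) + B3 *v u (t - \<tau>3))) (at t within {0..})"
    using x unfolding closed_loop_solutions_def by blast
  have cont_u: "continuous_on {-\<tau>3..} u"
  proof -
    have "continuous_on {-\<tau>3..} (\<lambda>t. K *v x t)"
      by (intro continuous_intros cont)
    then show ?thesis by (rule continuous_on_eq) (simp add: u)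
  qed
  have cont_V: "continuous_on {-\<tau>3..} (\<lambda>t. V (x t))"
    unfolding V_def by (intro continuous_intros cont)
  define D where "D = (\<lambda>t. delay_integral A B1 \<tau>3 \<tau>1 u t + delay_integral A B2 \<tau>3 \<tau>2 u t + delay_integral A B3 \<tau>3 \<tau>3 u t)"
  define z where "z = (\<lambda>t. x t + D t)"
  define J where "J = (\<lambda>t. integral {t-\<tau>3..t} (\<lambda>s. V (x s)))"
  have sub: "{t-\<tau>3..t} \<subseteq> {-\<tau>3..}" if "0 \<le> t" for t
    using that by auto
  have D_bound: "(norm (D t))\<^sup>2 \<le> C * (q * \<gamma> * J t)" if t: "0 \<le> t" for t
  proof -
    have "(norm (D t))\<^sup>2 \<le> C * integral {t-\<tau>3..t} (\<lambda>s. (norm (u s))\<^sup>2)"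
      unfolding D_def by (rule C(2) [OF cont_u t])
    also have "\<dots> \<le> C * integral {t-\<tau>3..t} (\<lambda>s. q * \<gamma> * V (x s))"
    proof (intro mult_left_mono integral_le C(1))
      show "(\<lambda>s. (norm (u s))\<^sup>2) integrable_on {t-\<tau>3..t}"
        by (intro integrable_continuous_real continuous_intros continuous_on_subset [OF cont_u sub [OF t]])
      show "(\<lambda>s. q * \<gamma> * V (x s)) integrable_on {t-\<tau>3..t}"
        by (intro integrable_continuous_real continuous_intros continuous_on_subset [OF cont_V sub [OF t]])
      show "(norm (u s))\<^sup>2 \<le> q * \<gamma> * V (x s)" if "s \<in> {t-\<tau>3..t}" for s
        using that t by (simp add: u K_bound)
    qed
    finally show ?thesis by (simp add: J_def)
  qed
  have VD_bound: "V (D t) \<le> p * (C * (q * \<gamma> * J t))" if t: "0 \<le> t" for t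
    using V_bound [of "D t"] mult_left_mono [OF D_bound [OF t] p(1)] by simp
  have z': "(z has_vector_derivative (A *v z t + B *v u t)) (at t within {0..})" if t: "0 \<le> t" for t
  proof -
    have 1: "(delay_integral A B1 \<tau>3 \<tau>1 u has_vector_derivative A *v delay_integral A B1 \<tau>3 \<tau>1 u t
        + matrix_exp (- \<tau>1 *\<^sub>R A) *v (B1 *v u t) - B1 *v u (t - \<tau>1)) (at t within {0..})"
      by (rule delay_integral_has_vector_derivative [OF cont_u]) (use delays t in auto)
    have 2: "(delay_integral A B2 \<tau>3 \<tau>2 u has_vector_derivative A *v delay_integral A B2 \<tau>3 \<tau>2 u t
        + matrix_exp (- \<tau>2 *\<^sub>R A) *v (B2 *v u t) - B2 *v u (t - \<tau>2)) (at t within {0..})"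
      by (rule delay_integral_has_vector_derivative [OF cont_u]) (use delays t in auto)
    have 3: "(delay_integral A B3 \<tau>3 \<tau>3 u has_vector_derivative A *v delay_integral A B3 \<tau>3 \<tau>3 u t
        + matrix_exp (- \<tau>3 *\<^sub>R A) *v (B3 *v u t) - B3 *v u (t - \<tau>3)) (at t within {0..})"
      by (rule delay_integral_has_vector_derivative [OF cont_u]) (use delays t in auto)
    have Bu: "B *v u t = matrix_exp (- \<tau>1 *\<^sub>R A) *v (B1 *v u t) + matrix_exp (- \<tau>2 *\<^sub>R A) *v (B2 *v u t)
        + matrix_exp (- \<tau>3 *\<^sub>R A) *v (B3 *v u t)"
      by (simp add: B matrix_vector_mult_add_rdistrib matrix_vector_mul_assoc)
    from has_vector_derivative_add [OF x' [OF t] has_vector_derivative_add [OF has_vector_derivative_add [OF 1 2] 3]]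
    show ?thesis
      unfolding z_def D_def
      by (rule has_vector_derivative_eq_rhs) (simp add: Bu matrix_vector_right_distrib)
  qed
  define Z' where "Z' = (\<lambda>t. z t \<bullet> (P *v (A *v z t + B *v u t)) + (A *v z t + B *v u t) \<bullet> (P *v z t))"
  have "V (x t) \<le> (2 + \<beta> / ((2 * \<alpha> + 1) * \<gamma>))
    * (exp (- min (\<gamma> / 2) (1 / (2 * (2 * \<alpha> + 1) * (\<tau>3 + 1))) * t)
      * (V (z 0) + (2 * \<alpha> + 1) * \<gamma>\<^sup>2 * (\<tau>3 + 1) * J 0))"
  proof (rule delay_Lyapunov_decay [where v = "\<lambda>t. V (x t)" and Z = "\<lambda>t. V (z t)" and Z' = Z' and J = J])
    show "((\<lambda>t. V (z t)) has_real_derivative Z' t) (at t within {0..})" if t: "0 \<le> t" for t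
      unfolding has_real_derivative_iff_has_vector_derivative V_def Z'_def
      by (rule bounded_bilinear.has_vector_derivative [OF bounded_bilinear_inner z' [OF t]
            bounded_linear.has_vector_derivative [OF matrix_vector_mul_bounded_linear z' [OF t]]])
    show "Z' t \<le> - \<gamma> * V (z t) + \<alpha> * \<gamma>\<^sup>2 * (V (x t) + J t)" if t: "0 \<le> t" for t
    proof -
      let ?f = "F *v z t"
      define w where "w = u t - ?f"
      have "Z' t = 2 * ((P *v z t) \<bullet> (A *v z t)) + 2 * ((P *v z t) \<bullet> (B *v u t))"
        unfolding Z'_def positive_definite_inner_commute [OF P, of "z t", symmetric]
          inner_commute [of _ "P *v z t"]
        by (simp add: inner_add_right)
      moreover have "2 * ((P *v z t) \<bullet> (A *v z t)) = (norm ?f)\<^sup>2 - \<gamma> * V (z t)"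
        using riccati_quadratic_form [OF P ric, of "z t"] by (simp add: F_eq V_def)
      moreover have "(P *v z t) \<bullet> (B *v u t) = - (?f \<bullet> u t)"
        by (simp add: F_eq inner_transpose_mult)
      moreover have "?f \<bullet> u t = (norm ?f)\<^sup>2 + ?f \<bullet> w"
        by (simp add: w_def inner_diff_right power2_norm_eq_inner)
      \<comment> \<open>Completing the square: with u = F z + w the derivative is - \<gamma> V(z) -
        |F z|^2 - 2 (F z) . w, and the last two terms are at most |w|^2.\<close>
      moreover have "0 \<le> (norm ?f)\<^sup>2 + 2 * (?f \<bullet> w) + (norm w)\<^sup>2"
        using zero_le_power2 [of "norm (?f + w)"]
        by (simp add: power2_norm_eq_inner inner_add_left inner_add_right inner_commute)
      ultimately have Z'_le: "Z' t \<le> - \<gamma> * V (z t) + (norm w)\<^sup>2"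
        by simp
      have FD: "(norm (F *v D t))\<^sup>2 \<le> \<gamma> * n * (p * (C * (q * \<gamma> * J t)))"
      proof -
        have "\<gamma> * n * V (D t) \<le> \<gamma> * n * (p * (C * (q * \<gamma> * J t)))"
          using \<gamma> n by (intro mult_left_mono VD_bound t) simp
        with F_bound [of "D t"] show ?thesis by linarith
      qed
      have "w = (K *v x t - F *v x t) + - (F *v D t)"
        using t \<tau>3 by (simp add: w_def u z_def matrix_vector_right_distrib)
      then have "(norm w)\<^sup>2 \<le> 2 * (norm (K *v x t - F *v x t))\<^sup>2 + 2 * (norm (F *v D t))\<^sup>2"
        using power2_norm_add_le [of "K *v x t - F *v x t" "- (F *v D t)"] by (simp only: norm_minus_cancel)
      also have "\<dots> \<le> 2 * (\<kappa> * \<gamma>\<^sup>2 * V (x t)) + 2 * (\<gamma> * n * (p * (C * (q * \<gamma> * J t))))"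
        by (intro add_mono mult_left_mono \<kappa>(2) FD) simp_all
      also have "\<dots> = (2 * \<kappa>) * (\<gamma>\<^sup>2 * V (x t)) + (2 * n * p * C * q) * (\<gamma>\<^sup>2 * J t)"
        by (simp add: power2_eq_square)
      also have "\<dots> \<le> \<alpha> * (\<gamma>\<^sup>2 * V (x t)) + \<alpha> * (\<gamma>\<^sup>2 * J t)"
      proof (intro add_mono mult_right_mono)
        show "2 * \<kappa> \<le> \<alpha>" "2 * n * p * C * q \<le> \<alpha>"
          using n p(1) C(1) q \<kappa>(1) by (simp_all add: \<alpha>_def)
        have "0 \<le> J t"
          unfolding J_def
          by (intro integral_nonneg integrable_continuous_real continuous_on_subset [OF cont_V sub [OF t]] V_nonneg)
        then show "0 \<le> \<gamma>\<^sup>2 * J t" by simp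
        show "0 \<le> \<gamma>\<^sup>2 * V (x t)" by (simp add: V_nonneg)
      qed
      also have "\<dots> = \<alpha> * \<gamma>\<^sup>2 * (V (x t) + J t)"
        by (simp only: distrib_left mult.assoc)
      finally show ?thesis using Z'_le by linarith
    qed
    show "V (x t) \<le> 2 * V (z t) + \<beta> * \<gamma> * J t" if t: "0 \<le> t" for t
    proof -
      have "V (x t) \<le> 2 * V (z t) + 2 * V (- D t)"
        using positive_definite_add_le [OF P, of "z t" "- D t"] by (simp add: z_def V_def)
      moreover have "V (- D t) = V (D t)"
        using matrix_vector_mult_scaleR [of P "-1" "D t"] by (simp add: V_def)
      ultimately have "V (x t) \<le> 2 * V (z t) + 2 * (p * (C * (q * \<gamma> * J t)))"
        using VD_bound [OF t] by linarith
      then show ?thesis by (simp add: \<beta>_def mult_ac)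
    qed
  qed (use \<tau>3 cont_V V_nonneg \<gamma> \<alpha> \<beta> small1 small2 t in \<open>simp_all add: J_def\<close>)
  also have "\<dots> \<le> (2 + \<beta> / ((2 * \<alpha> + 1) * \<gamma>))
    * (exp (- min (\<gamma> / 2) (1 / (2 * (2 * \<alpha> + 1) * (\<tau>3 + 1))) * t)
      * (2 * p * \<eta>\<^sup>2 + (\<beta> * \<gamma> + (2 * \<alpha> + 1) * \<gamma>\<^sup>2 * (\<tau>3 + 1)) * (\<tau>3 * (p * \<eta>\<^sup>2))))"
  proof (intro mult_left_mono)
    have V_init: "V (x s) \<le> p * \<eta>\<^sup>2" if "s \<in> {-\<tau>3..0}" for s
    proof -
      have "p * (norm (x s))\<^sup>2 \<le> p * \<eta>\<^sup>2"
        by (intro mult_left_mono power_mono init that p norm_ge_zero)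
      with V_bound [of "x s"] show ?thesis by simp
    qed
    have J0: "J 0 \<le> \<tau>3 * (p * \<eta>\<^sup>2)"
    proof -
      have "J 0 \<le> integral {0-\<tau>3..0} (\<lambda>s. p * \<eta>\<^sup>2)"
        unfolding J_def
        by (intro integral_le integrable_continuous_real continuous_on_subset [OF cont_V sub] continuous_intros V_init) simp_all
      then show ?thesis using \<tau>3 by (simp add: mult_ac)
    qed
    \<comment> \<open>The initial value of z involves past inputs, so it is estimated through the
      initial history of x as well.\<close>
    have "V (z 0) \<le> 2 * V (x 0) + 2 * V (D 0)"
      using positive_definite_add_le [OF P, of "x 0" "D 0"] by (simp add: z_def V_def)
    also have "\<dots> \<le> 2 * (p * \<eta>\<^sup>2) + \<beta> * \<gamma> * J 0"
      using V_init [of 0] VD_bound [of 0] \<tau>3 by (simp add: \<beta>_def mult_ac)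
    finally have "V (z 0) + (2 * \<alpha> + 1) * \<gamma>\<^sup>2 * (\<tau>3 + 1) * J 0
        \<le> 2 * p * \<eta>\<^sup>2 + (\<beta> * \<gamma> + (2 * \<alpha> + 1) * \<gamma>\<^sup>2 * (\<tau>3 + 1)) * J 0"
      by (simp add: algebra_simps)
    also have "\<dots> \<le> 2 * p * \<eta>\<^sup>2 + (\<beta> * \<gamma> + (2 * \<alpha> + 1) * \<gamma>\<^sup>2 * (\<tau>3 + 1)) * (\<tau>3 * (p * \<eta>\<^sup>2))"
      using \<alpha> \<beta> \<gamma> \<tau>3 by (intro add_left_mono mult_left_mono J0) simp
    finally show "V (z 0) + (2 * \<alpha> + 1) * \<gamma>\<^sup>2 * (\<tau>3 + 1) * J 0
        \<le> 2 * p * \<eta>\<^sup>2 + (\<beta> * \<gamma> + (2 * \<alpha> + 1) * \<gamma>\<^sup>2 * (\<tau>3 + 1)) * (\<tau>3 * (p * \<eta>\<^sup>2))" .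
  qed (use \<alpha> \<beta> \<gamma> in simp_all)
  finally show ?thesis .
qed

theorem theorem1:
  fixes A :: "real^'n^'n" and B1 B2 B3 B :: "real^'m^'n"
    and \<tau>1 \<tau>2 \<tau>3 \<tau> :: real
  assumes delays: "0 \<le> \<tau>1" "\<tau>1 \<le> \<tau>2" "\<tau>2 \<le> \<tau>3"
    and tau: "\<tau> = \<tau>1 + \<tau>2 + \<tau>3"
    and B: "B = matrix_exp (- (\<tau>1 *\<^sub>R A)) ** B1 + matrix_exp (- (\<tau>2 *\<^sub>R A)) ** B2
                + matrix_exp (- (\<tau>3 *\<^sub>R A)) ** B3"
    and ctrb: "controllable A B"
    and spectrum: "\<forall>\<mu>. complex_eigenvalue A \<mu> \<longrightarrow> Re \<mu> = 0"
  shows "\<exists>\<gamma>star>0. \<forall>\<gamma>. 0 < \<gamma> \<and> \<gamma> < \<gamma>star \<longrightarrow>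
     (\<forall>P F. positive_definite P \<and> riccati A B \<gamma> P \<and> F = - (transpose B ** P) \<longrightarrow>
        asymptotically_stable \<tau>3
          (closed_loop_solutions A B1 B2 B3 \<tau>1 \<tau>2 \<tau>3
             (F ** matrix_exp (\<tau> *\<^sub>R (A + B ** F)) ** matrix_exp (- (\<tau> *\<^sub>R A)))))"
proof -
  have tr: "trace A = 0"
    by (rule trace_eq_0 [OF spectrum])
  have \<tau>: "0 \<le> \<tau>" and \<tau>3: "0 \<le> \<tau>3" using delays tau by simp_all
  \<comment> \<open>The constants \<open>p\<close>, \<kappa> and \<open>C\<close> hold for all
    \<gamma> \<le> 1 and all \<open>P\<close>; this uniformity lets the threshold be chosen before
    \<gamma> and \<open>P\<close>.\<close>
  obtain p where p: "p > 0" "\<And>\<gamma> P v. 0 < \<gamma> \<Longrightarrow> \<gamma> \<le> 1 \<Longrightarrow> positive_definite P \<Longrightarrow>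
      riccati A B \<gamma> P \<Longrightarrow> norm (P *v v) \<le> p * norm v"
    using riccati_bound [OF ctrb] by metis
  obtain \<kappa> where \<kappa>: "0 \<le> \<kappa>"
    "\<And>\<gamma> P F x. 0 < \<gamma> \<Longrightarrow> \<gamma> \<le> 1 \<Longrightarrow> positive_definite P \<Longrightarrow> riccati A B \<gamma> P \<Longrightarrow>
      F = - (transpose B ** P) \<Longrightarrow>
      (norm ((F ** matrix_exp (\<tau> *\<^sub>R (A + B ** F)) ** matrix_exp (- (\<tau> *\<^sub>R A))) *v x - F *v x))\<^sup>2
        \<le> \<kappa> * \<gamma>\<^sup>2 * quadratic_form P x"
    using truncated_gain_estimate [OF ctrb tr \<tau>] by blast
  obtain C where C: "0 \<le> C"
    "\<And>u t. continuous_on {-\<tau>3..} u \<Longrightarrow> 0 \<le> t \<Longrightarrow>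
      (norm (delay_integral A B1 \<tau>3 \<tau>1 u t + delay_integral A B2 \<tau>3 \<tau>2 u t + delay_integral A B3 \<tau>3 \<tau>3 u t))\<^sup>2
        \<le> C * integral {t-\<tau>3..t} (\<lambda>s. (norm (u s))\<^sup>2)"
    using three_delay_integrals_bound [OF delays] by blast
  define q where "q = 2 * (real CARD('n) + \<kappa>)"
  define \<alpha> where "\<alpha> = 2 * \<kappa> + 2 * real CARD('n) * p * C * q"
  define \<beta> where "\<beta> = 2 * p * C * q"
  define c where "c = \<alpha> + (2 * \<alpha> + 1) * (\<tau>3 + 1)"
  have nonneg: "0 \<le> \<alpha>" "0 \<le> \<beta>"
    using p(1) C(1) \<kappa>(1) by (simp_all add: \<alpha>_def \<beta>_def q_def)
  have c: "0 \<le> c" using nonneg \<tau>3 by (simp add: c_def)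
  \<comment> \<open>The denominator is the sum of the coefficients of \<gamma> in the three
    smallness conditions, so one inequality implies them all.\<close>
  define \<gamma>star where "\<gamma>star = 1 / (1 + 4 * c + 2 * c * \<beta>)"
  have den: "1 \<le> 1 + 4 * c + 2 * c * \<beta>" using c nonneg by simp
  have "0 < \<gamma>star" using den by (simp add: \<gamma>star_def)
  moreover have "asymptotically_stable \<tau>3 (closed_loop_solutions A B1 B2 B3 \<tau>1 \<tau>2 \<tau>3
      (F ** matrix_exp (\<tau> *\<^sub>R (A + B ** F)) ** matrix_exp (- (\<tau> *\<^sub>R A))))"
    if \<gamma>: "0 < \<gamma>" "\<gamma> < \<gamma>star" and P: "positive_definite P" and ric: "riccati A B \<gamma> P"
      and F: "F = - (transpose B ** P)" for \<gamma> P F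
  proof -
    have "\<gamma> * (1 + 4 * c + 2 * c * \<beta>) < 1"
      using \<gamma>(2) den by (simp add: \<gamma>star_def field_simps)
    moreover have "0 \<le> c * \<gamma>" "0 \<le> c * \<beta> * \<gamma>"
      using c nonneg \<gamma>(1) by simp_all
    ultimately have small: "\<gamma> \<le> 1" "4 * c * \<gamma> \<le> 1" "2 * c * \<beta> * \<gamma> \<le> 1"
      using \<gamma>(1) by (simp_all add: algebra_simps)
    \<comment> \<open>This bound depends on \<open>P\<close>, hence on \<gamma>. It affects only the
      multiplicative constant of the decay, not the threshold.\<close>
    obtain l where l: "l > 0" "\<And>v. l * (norm v)\<^sup>2 \<le> quadratic_form P v"
      using positive_definite_lower_bound [OF P] by metis
    \<comment> \<open>The constant of \<open>closed_loop_decay\<close> with the square of the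
      initial bound \<eta> factored out.\<close>
    define M where "M = (2 + \<beta> / ((2 * \<alpha> + 1) * \<gamma>)) *
      (2 * p + (\<beta> * \<gamma> + (2 * \<alpha> + 1) * \<gamma>\<^sup>2 * (\<tau>3 + 1)) * (\<tau>3 * p))"
    define \<sigma> where "\<sigma> = min (\<gamma> / 2) (1 / (2 * (2 * \<alpha> + 1) * (\<tau>3 + 1)))"
    let ?K = "F ** matrix_exp (\<tau> *\<^sub>R (A + B ** F)) ** matrix_exp (- (\<tau> *\<^sub>R A))"
    show ?thesis
    proof (rule asymptotically_stableI)
      show "0 \<le> M / l"
        using nonneg \<gamma> p(1) \<tau>3 l(1) by (simp add: M_def)
      show "0 < \<sigma>"
        using nonneg \<gamma> \<tau>3 by (simp add: \<sigma>_def)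
      fix x
      assume x: "x \<in> closed_loop_solutions A B1 B2 B3 \<tau>1 \<tau>2 \<tau>3 ?K"
      show "continuous_on {-\<tau>3..0} x"
        using x unfolding closed_loop_solutions_def by (auto intro: continuous_on_subset)
      fix \<eta> t :: real
      assume init: "\<And>s. s \<in> {-\<tau>3..0} \<Longrightarrow> norm (x s) \<le> \<eta>" and t: "0 \<le> t"
      have "l * (norm (x t))\<^sup>2 \<le> quadratic_form P (x t)"
        by (rule l(2))
      also have "\<dots> \<le> (2 + \<beta> / ((2 * \<alpha> + 1) * \<gamma>)) * (exp (- \<sigma> * t)
          * (2 * p * \<eta>\<^sup>2 + (\<beta> * \<gamma> + (2 * \<alpha> + 1) * \<gamma>\<^sup>2 * (\<tau>3 + 1)) * (\<tau>3 * (p * \<eta>\<^sup>2))))"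
        unfolding \<sigma>_def \<alpha>_def \<beta>_def q_def
        by (rule closed_loop_decay [OF delays B tr P ric F \<gamma>(1) small(1) _ p(2) [OF \<gamma>(1) small(1) P ric]
              \<kappa>(1) \<kappa>(2) [OF \<gamma>(1) small(1) P ric F] C
              small(2) [unfolded c_def \<alpha>_def \<beta>_def q_def] small(3) [unfolded c_def \<alpha>_def \<beta>_def q_def] x init t])
          (use p(1) in simp_all)
      also have "\<dots> = M * exp (- \<sigma> * t) * \<eta>\<^sup>2"
        by (simp add: M_def algebra_simps)
      finally show "(norm (x t))\<^sup>2 \<le> M / l * exp (- \<sigma> * t) * \<eta>\<^sup>2"
        using l(1) by (simp add: field_simps)
    qed
  qed
  ultimately show ?thesis by blast
qed

end
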